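(* Let $\mathbb H$ be a subgroup of the additive group $\mathbb R$ with $1\in\mathbb H$, and let $M=(M_t:t\in[0,1]_{\mathbb H})$ be a weak $\mathbb H$-perfect pseudo MV-algebra which is not strong. Then there is a unique (up to isomorphism) $\ell$-group $G$ with an element $b\in G^+$, $b>0$, such that $M\cong\Gamma(\mathbb H\overrightarrow{\times}G,(1,b))$ (isomorphism of pseudo MV-algebras).
   Context: A pseudo MV-algebra (PMV-algebra) is an algebra $(M;\oplus,{}^-,{}^\sim,0,1)$ of type $(2,1,1,0,0)$ such that, with $y\odot x:=(x^-\oplus y^-)^\sim$ ($\odot$ binds tighter than $\oplus$), for all $x,y,z\in M$: (A1) $x\oplus(y\oplus z)=(x\oplus y)\oplus z$; (A2) $x\oplus0=0\oplus x=x$; (A3) $x\oplus1=1\oplus x=1$; (A4) $1^\sim=0$, $1^-=0$; (A5) $(x^-\oplus y^-)^\sim=(x^\sim\oplus y^\sim)^-$; (A6) $x\oplus(x^\sim\odot y)=y\oplus(y^\sim\odot x)=(x\odot y^-)\oplus y=(y\odot x^-)\oplus x$; (A7) $x\odot(x^-\oplus y)=(x\oplus y^\sim)\odot y$; (A8) $(x^-)^\sim=x$. The term in (A6) is the join, the term in (A7) the meet of a distributive lattice with order $\le$. The partial addition: $x+y$ is defined iff $x\le y^-$, and then $x+y:=x\oplus y$. An $\ell$-group is a (not necessarily Abelian, additively written) lattice-ordered group; $G^+=\{g\in G:g\ge0\}$; $C(G)$ denotes the center of $G$. A strong unit of $G$ is $u\ge0$ such that every $g\in G$ satisfies $g\le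 nu$ for some integer $n\ge1$. $\Gamma(G,u):=[0,u]$ with $x\oplus y=(x+y)\wedge u$, $x^-=u-x$, $x^\sim=-x+u$, $0$, $u$ is a PMV-algebra. Every PMV-algebra is isomorphic to $\Gamma(G,u)$ for a unital $\ell$-group $(G,u)$ unique up to isomorphism (known theorem), and is identified with it. $\mathbb H\overrightarrow{\times}G$ is the lexicographic product: the group $\mathbb H\times G$ with $(h_1,g_1)\le(h_2,g_2)$ iff $h_1<h_2$, or $h_1=h_2$ and $g_1\le g_2$. $[0,1]_{\mathbb H}:=[0,1]\cap\mathbb H$. For subsets, $A\leqslant B$ means $a\le b$ for all $a\in A,b\in B$; $A^-=\{a^-:a\in A\}$, $A^\sim=\{a^\sim:a\in A\}$. $M=(M_t:t\in[0,1]_{\mathbb H})$ is $\mathbb H$-perfect if $(M_t)$ is a system of nonempty, pairwise disjoint subsets with union $M$ such that (a) $M_s\leqslant M_t$ for $s<t$; (b) $M_t^-=M_{1-t}=M_t^\sim$; (c) if $x\in M_v$, $y\in M_t$ then $x\oplus y\in M_{\min\{v+t,1\}}$ (such a system is unique when it exists). An $\mathbb H$-perfect $M=\Gamma(G,u)=(M_t:t\in[0,1]_{\mathbb H})$ is weak if there are elements $(c_t:t\in[0,1]_{\mathbb H})$ of $M$ with (i) $c_0=0$; (ii) $c_t\in C(G)\cap M_t$ for all $t$; (iii) $c_{v+t}=c_v+c_t$ whenever $v+t\le1$. It is strong if such a system can be chosen with, in addition, $c_1=1$ (the top element of $M$). *)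

theory Defs
  imports Complex_Main "HOL-Algebra.Group" "HOL-Library.Disjoint_Sets"
begin

section \<open>Lattice-ordered groups\<close>

text \<open>
  The groups are not assumed to be Abelian. They are handled in the multiplicative notation of
  HOL-Algebra: the additively written \<open>x + y\<close>, \<open>- x\<close>, \<open>0\<close>, \<open>n x\<close> of an l-group become
  \<open>x \<otimes> y\<close>, \<open>inv x\<close>, \<open>\<one>\<close>, \<open>x [^] n\<close>.
\<close>

record 'a ordered_monoid = "'a monoid" +
  grp_le :: "'a \<Rightarrow> 'a \<Rightarrow> bool" (infixl \<open>\<preceq>\<index>\<close> 50)

definition order_of :: "('a, 'm) ordered_monoid_scheme \<Rightarrow> 'a gorder"
  where "order_of G = \<lparr>carrier = carrier G, eq = (=), le = grp_le G\<rparr>"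

locale lgroup = group G for G (structure) +
  assumes lattice_order: "lattice (order_of G)"
    and mult_left_mono:
      "\<lbrakk>x \<in> carrier G; y \<in> carrier G; z \<in> carrier G; x \<preceq> y\<rbrakk> \<Longrightarrow> z \<otimes> x \<preceq> z \<otimes> y"
    and mult_right_mono:
      "\<lbrakk>x \<in> carrier G; y \<in> carrier G; z \<in> carrier G; x \<preceq> y\<rbrakk> \<Longrightarrow> x \<otimes> z \<preceq> y \<otimes> z"

definition lgroup_isomorphic ::
  "('a, 'm) ordered_monoid_scheme \<Rightarrow> ('b, 'n) ordered_monoid_scheme \<Rightarrow> bool"
  where "lgroup_isomorphic G K \<longleftrightarrow>
    (\<exists>h \<in> iso G K. join_pres (order_of G) (order_of K) h \<and> meet_pres (order_of G) (order_of K) h)"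

definition center :: "('a, 'm) monoid_scheme \<Rightarrow> 'a set"
  where "center G = {z \<in> carrier G. \<forall>x \<in> carrier G. z \<otimes>\<^bsub>G\<^esub> x = x \<otimes>\<^bsub>G\<^esub> z}"

definition strong_unit :: "('a, 'm) ordered_monoid_scheme \<Rightarrow> 'a \<Rightarrow> bool"
  where "strong_unit G u \<longleftrightarrow> u \<in> carrier G \<and> \<one>\<^bsub>G\<^esub> \<preceq>\<^bsub>G\<^esub> u \<and>
    (\<forall>g \<in> carrier G. \<exists>n::nat. n \<ge> 1 \<and> g \<preceq>\<^bsub>G\<^esub> u [^]\<^bsub>G\<^esub> n)"

definition real_lgroup :: "real ordered_monoid"
  where "real_lgroup = \<lparr>carrier = UNIV, monoid.mult = (+), one = 0, grp_le = (\<le>)\<rparr>"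

definition lex_prod ::
  "('a, 'm) ordered_monoid_scheme \<Rightarrow> ('b, 'n) ordered_monoid_scheme \<Rightarrow> ('a \<times> 'b) ordered_monoid"
  where "lex_prod A B =
    \<lparr>carrier = carrier (A \<times>\<times> B), monoid.mult = mult (A \<times>\<times> B), one = one (A \<times>\<times> B),
     grp_le = (\<lambda>(a1, b1) (a2, b2). a1 \<preceq>\<^bsub>A\<^esub> a2 \<and> a1 \<noteq> a2 \<or> a1 = a2 \<and> b1 \<preceq>\<^bsub>B\<^esub> b2)\<rparr>"


section \<open>Pseudo MV-algebras\<close>

record 'a pmv = "'a partial_object" +
  psum :: "'a \<Rightarrow> 'a \<Rightarrow> 'a" (infixl \<open>\<oplus>\<index>\<close> 65)
  lneg :: "'a \<Rightarrow> 'a"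
  rneg :: "'a \<Rightarrow> 'a"
  pzero :: 'a
  pone :: 'a

text \<open>\<open>lneg x\<close> is \<open>x\<^sup>-\<close> and \<open>rneg x\<close> is \<open>x\<^sup>\<sim>\<close>. Mind the reversed order of the
  arguments in \<open>y \<odot> x = (x\<^sup>- \<oplus> y\<^sup>-)\<^sup>\<sim>\<close>.\<close>

definition pprod :: "('a, 'm) pmv_scheme \<Rightarrow> 'a \<Rightarrow> 'a \<Rightarrow> 'a" (infixl \<open>\<odot>\<index>\<close> 70)
  where "y \<odot>\<^bsub>M\<^esub> x = rneg M (lneg M x \<oplus>\<^bsub>M\<^esub> lneg M y)"

locale pseudo_mv_algebra =
  fixes M (structure)
  assumes psum_closed: "\<lbrakk>x \<in> carrier M; y \<in> carrier M\<rbrakk> \<Longrightarrow> x \<oplus> y \<in> carrier M"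
    and lneg_closed: "x \<in> carrier M \<Longrightarrow> lneg M x \<in> carrier M"
    and rneg_closed: "x \<in> carrier M \<Longrightarrow> rneg M x \<in> carrier M"
    and pzero_closed: "pzero M \<in> carrier M"
    and pone_closed: "pone M \<in> carrier M"
    and A1: "\<lbrakk>x \<in> carrier M; y \<in> carrier M; z \<in> carrier M\<rbrakk> \<Longrightarrow> x \<oplus> (y \<oplus> z) = (x \<oplus> y) \<oplus> z"
    and A2: "x \<in> carrier M \<Longrightarrow> x \<oplus> pzero M = x" "x \<in> carrier M \<Longrightarrow> pzero M \<oplus> x = x"
    and A3: "x \<in> carrier M \<Longrightarrow> x \<oplus> pone M = pone M" "x \<in> carrier M \<Longrightarrow> pone M \<oplus> x = pone M"
    and A4: "rneg M (pone M) = pzero M" "lneg M (pone M) = pzero M"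
    and A5: "\<lbrakk>x \<in> carrier M; y \<in> carrier M\<rbrakk> \<Longrightarrow>
      rneg M (lneg M x \<oplus> lneg M y) = lneg M (rneg M x \<oplus> rneg M y)"
    and A6: "\<lbrakk>x \<in> carrier M; y \<in> carrier M\<rbrakk> \<Longrightarrow> x \<oplus> (rneg M x \<odot> y) = y \<oplus> (rneg M y \<odot> x)"
      "\<lbrakk>x \<in> carrier M; y \<in> carrier M\<rbrakk> \<Longrightarrow> y \<oplus> (rneg M y \<odot> x) = (x \<odot> lneg M y) \<oplus> y"
      "\<lbrakk>x \<in> carrier M; y \<in> carrier M\<rbrakk> \<Longrightarrow> (x \<odot> lneg M y) \<oplus> y = (y \<odot> lneg M x) \<oplus> x"
    and A7: "\<lbrakk>x \<in> carrier M; y \<in> carrier M\<rbrakk> \<Longrightarrow> x \<odot> (lneg M x \<oplus> y) = (x \<oplus> rneg M y) \<odot> y"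
    and A8: "x \<in> carrier M \<Longrightarrow> rneg M (lneg M x) = x"

definition pjoin :: "('a, 'm) pmv_scheme \<Rightarrow> 'a \<Rightarrow> 'a \<Rightarrow> 'a"
  where "pjoin M x y = x \<oplus>\<^bsub>M\<^esub> (rneg M x \<odot>\<^bsub>M\<^esub> y)"

definition pmv_le :: "('a, 'm) pmv_scheme \<Rightarrow> 'a \<Rightarrow> 'a \<Rightarrow> bool"
  where "pmv_le M x y \<longleftrightarrow> pjoin M x y = y"

definition pmv_iso :: "('a, 'm) pmv_scheme \<Rightarrow> ('b, 'n) pmv_scheme \<Rightarrow> ('a \<Rightarrow> 'b) set"
  where "pmv_iso M N = {f. bij_betw f (carrier M) (carrier N) \<and>
    (\<forall>x \<in> carrier M. \<forall>y \<in> carrier M. f (x \<oplus>\<^bsub>M\<^esub> y) = f x \<oplus>\<^bsub>N\<^esub> f y) \<and>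
    (\<forall>x \<in> carrier M. f (lneg M x) = lneg N (f x)) \<and>
    (\<forall>x \<in> carrier M. f (rneg M x) = rneg N (f x)) \<and>
    f (pzero M) = pzero N \<and> f (pone M) = pone N}"

definition Gamma :: "('a, 'm) ordered_monoid_scheme \<Rightarrow> 'a \<Rightarrow> 'a pmv"
  where "Gamma G u =
    \<lparr>carrier = {x \<in> carrier G. \<one>\<^bsub>G\<^esub> \<preceq>\<^bsub>G\<^esub> x \<and> x \<preceq>\<^bsub>G\<^esub> u},
     psum = (\<lambda>x y. (x \<otimes>\<^bsub>G\<^esub> y) \<sqinter>\<^bsub>order_of G\<^esub> u),
     lneg = (\<lambda>x. u \<otimes>\<^bsub>G\<^esub> inv\<^bsub>G\<^esub> x),
     rneg = (\<lambda>x. inv\<^bsub>G\<^esub> x \<otimes>\<^bsub>G\<^esub> u),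
     pzero = \<one>\<^bsub>G\<^esub>,
     pone = u\<rparr>"


section \<open>Perfect pseudo MV-algebras\<close>

definition unit_interval_of :: "real set \<Rightarrow> real set"
  where "unit_interval_of H = {0..1} \<inter> H"

definition perfect :: "real set \<Rightarrow> ('a, 'm) pmv_scheme \<Rightarrow> (real \<Rightarrow> 'a set) \<Rightarrow> bool"
  where "perfect H M Ms \<longleftrightarrow>
    (\<forall>t \<in> unit_interval_of H. Ms t \<noteq> {}) \<and>
    disjoint_family_on Ms (unit_interval_of H) \<and>
    (\<Union>t \<in> unit_interval_of H. Ms t) = carrier M \<and>
    (\<forall>s \<in> unit_interval_of H. \<forall>t \<in> unit_interval_of H. s < t \<longrightarrow>
      (\<forall>x \<in> Ms s. \<forall>y \<in> Ms t. pmv_le M x y)) \<and>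
    (\<forall>t \<in> unit_interval_of H. lneg M ` Ms t = Ms (1 - t) \<and> rneg M ` Ms t = Ms (1 - t)) \<and>
    (\<forall>v \<in> unit_interval_of H. \<forall>t \<in> unit_interval_of H. \<forall>x \<in> Ms v. \<forall>y \<in> Ms t.
      x \<oplus>\<^bsub>M\<^esub> y \<in> Ms (min (v + t) 1))"

text \<open>
  Centrality of the elements \<open>c t\<close> of \<open>M\<close> refers to a unital l-group representing \<open>M\<close>. Here
  \<open>f\<close> is the isomorphism of \<open>M\<close> onto \<open>Gamma L u\<close> along which \<open>M\<close> is identified with
  \<open>Gamma L u\<close>. The first conjunct of the last clause says that the partial sum of \<open>c v\<close> and
  \<open>c t\<close> is defined.
\<close>

definition central_system ::
  "real set \<Rightarrow> ('a, 'm) pmv_scheme \<Rightarrow> (real \<Rightarrow> 'a set) \<Rightarrow>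
   ('l, 'n) ordered_monoid_scheme \<Rightarrow> ('a \<Rightarrow> 'l) \<Rightarrow> (real \<Rightarrow> 'a) \<Rightarrow> bool"
  where "central_system H M Ms L f c \<longleftrightarrow>
    c 0 = pzero M \<and>
    (\<forall>t \<in> unit_interval_of H. f (c t) \<in> center L \<and> c t \<in> Ms t) \<and>
    (\<forall>v \<in> unit_interval_of H. \<forall>t \<in> unit_interval_of H. v + t \<le> 1 \<longrightarrow>
      pmv_le M (c v) (lneg M (c t)) \<and> c (v + t) = c v \<oplus>\<^bsub>M\<^esub> c t)"

definition weak_perfect ::
  "real set \<Rightarrow> ('a, 'm) pmv_scheme \<Rightarrow> (real \<Rightarrow> 'a set) \<Rightarrow>
   ('l, 'n) ordered_monoid_scheme \<Rightarrow> ('a \<Rightarrow> 'l) \<Rightarrow> bool"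
  where "weak_perfect H M Ms L f \<longleftrightarrow> perfect H M Ms \<and> (\<exists>c. central_system H M Ms L f c)"

definition strong_perfect ::
  "real set \<Rightarrow> ('a, 'm) pmv_scheme \<Rightarrow> (real \<Rightarrow> 'a set) \<Rightarrow>
   ('l, 'n) ordered_monoid_scheme \<Rightarrow> ('a \<Rightarrow> 'l) \<Rightarrow> bool"
  where "strong_perfect H M Ms L f \<longleftrightarrow>
    perfect H M Ms \<and> (\<exists>c. central_system H M Ms L f c \<and> c 1 = pone M)"

text \<open>\<open>real_lgroup\<lparr>carrier := H\<rparr>\<close> is the subgroup \<open>H\<close> of the reals as an l-group.\<close>

definition lex_represents ::
  "real set \<Rightarrow> ('a, 'm) pmv_scheme \<Rightarrow> ('g, 'n) ordered_monoid_scheme \<Rightarrow> 'g \<Rightarrow> bool"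
  where "lex_represents H M G b \<longleftrightarrow>
    lgroup G \<and> b \<in> carrier G \<and> \<one>\<^bsub>G\<^esub> \<preceq>\<^bsub>G\<^esub> b \<and> b \<noteq> \<one>\<^bsub>G\<^esub> \<and>
    pmv_iso M (Gamma (lex_prod (real_lgroup\<lparr>carrier := H\<rparr>) G) (1, b)) \<noteq> {}"

end

(* The algebra is graded by S t, the image of M_t in L, and each S t is a translate by c_t of the
   convex subgroup C of L whose positive cone is S 0, cut down to the interval [1, u]. This holds
   because for x, y in S t the positive part of y x^-1 is bounded by (x + y^~)^-, which lies in
   S (1 - 1) = S 0. Since the c_t are central and additive, (t, g) |-> c_t g is an isomorphism of
   the interval of H x C below (1, b) onto the interval of L below u, where b = u c_1^-1; here
   b is not the unit precisely because c_1 is not the top element.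

   For uniqueness, the elements (0, g) with g positive are exactly those x for which no n-fold sum
   x + ... + x is the top element. So M determines the positive cone of G as an ordered monoid,
   and G is its group of quotients. *)

theory Submission
  imports Defs
begin

section \<open>Lattice-ordered groups\<close>

text \<open>Two obstacles shape the proof. The central elements are given only for indices in [0,1]
  and H, so no map between the whole groups H x C and L is written down. The isomorphism is checked
  on the interval alone, and sums whose index passes 1 need an argument of their own. Likewise the
  lexicographic product is never set up as an l-group: its inverses and meets are computed by
  coordinates. The other obstacle is noncommutativity. An element of an l-group is a quotient a b^-1
  of positive ones, and a map of positive cones extends to quotients only because two of them can be
  brought to a common denominator, which the join supplies. The construction of C starts from the
  fact that 0 and 1 are distinct indices: layer 0 lies below layer 1, so products inside layer 0
  stay below u and are not truncated. This makes layer 0 closed under the group operation, and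
  together with convexity it becomes the positive cone of C.\<close>

lemma order_of_simps [simp]:
  "carrier (order_of G) = carrier G" "eq (order_of G) = (=)" "le (order_of G) = grp_le G"
  by (simp_all add: order_of_def)

context lgroup
begin

abbreviation ljoin (infixl \<open>\<squnion>\<^sub>G\<close> 65) where "x \<squnion>\<^sub>G y \<equiv> x \<squnion>\<^bsub>order_of G\<^esub> y"
abbreviation lmeet (infixl \<open>\<sqinter>\<^sub>G\<close> 70) where "x \<sqinter>\<^sub>G y \<equiv> x \<sqinter>\<^bsub>order_of G\<^esub> y"

lemma le_refl [simp]: "x \<in> carrier G \<Longrightarrow> x \<preceq> x"
proof -
  interpret ord: lattice "order_of G" by (rule lattice_order)
  show "x \<in> carrier G \<Longrightarrow> x \<preceq> x" using ord.le_refl by simp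
qed

lemma le_trans [trans]:
  "\<lbrakk>x \<preceq> y; y \<preceq> z; x \<in> carrier G; y \<in> carrier G; z \<in> carrier G\<rbrakk> \<Longrightarrow> x \<preceq> z"
proof -
  interpret ord: lattice "order_of G" by (rule lattice_order)
  show "\<lbrakk>x \<preceq> y; y \<preceq> z; x \<in> carrier G; y \<in> carrier G; z \<in> carrier G\<rbrakk> \<Longrightarrow> x \<preceq> z"
    using ord.le_trans by simp
qed

lemma le_antisym: "\<lbrakk>x \<preceq> y; y \<preceq> x; x \<in> carrier G; y \<in> carrier G\<rbrakk> \<Longrightarrow> x = y"
proof -
  interpret ord: lattice "order_of G" by (rule lattice_order)
  show "\<lbrakk>x \<preceq> y; y \<preceq> x; x \<in> carrier G; y \<in> carrier G\<rbrakk> \<Longrightarrow> x = y"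
    using ord.le_antisym by simp
qed

lemma join_facts:
  assumes "x \<in> carrier G" "y \<in> carrier G"
  shows join_closed: "x \<squnion>\<^sub>G y \<in> carrier G"
    and join_ge1: "x \<preceq> x \<squnion>\<^sub>G y" and join_ge2: "y \<preceq> x \<squnion>\<^sub>G y"
    and join_least: "\<lbrakk>z \<in> carrier G; x \<preceq> z; y \<preceq> z\<rbrakk> \<Longrightarrow> x \<squnion>\<^sub>G y \<preceq> z"
proof -
  interpret ord: lattice "order_of G" by (rule lattice_order)
  show "x \<squnion>\<^sub>G y \<in> carrier G" "x \<preceq> x \<squnion>\<^sub>G y" "y \<preceq> x \<squnion>\<^sub>G y"
    "\<lbrakk>z \<in> carrier G; x \<preceq> z; y \<preceq> z\<rbrakk> \<Longrightarrow> x \<squnion>\<^sub>G y \<preceq> z"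
    using assms ord.join_closed ord.join_left ord.join_right ord.join_le by simp_all
qed

lemma meet_facts:
  assumes "x \<in> carrier G" "y \<in> carrier G"
  shows meet_closed: "x \<sqinter>\<^sub>G y \<in> carrier G"
    and meet_le1: "x \<sqinter>\<^sub>G y \<preceq> x" and meet_le2: "x \<sqinter>\<^sub>G y \<preceq> y"
    and meet_greatest: "\<lbrakk>z \<in> carrier G; z \<preceq> x; z \<preceq> y\<rbrakk> \<Longrightarrow> z \<preceq> x \<sqinter>\<^sub>G y"
proof -
  interpret ord: lattice "order_of G" by (rule lattice_order)
  show "x \<sqinter>\<^sub>G y \<in> carrier G" "x \<sqinter>\<^sub>G y \<preceq> x" "x \<sqinter>\<^sub>G y \<preceq> y"
    "\<lbrakk>z \<in> carrier G; z \<preceq> x; z \<preceq> y\<rbrakk> \<Longrightarrow> z \<preceq> x \<sqinter>\<^sub>G y"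
    using assms ord.meet_closed ord.meet_left ord.meet_right ord.meet_le by simp_all
qed

lemma meet_eqI:
  assumes "x \<in> carrier G" "y \<in> carrier G" "m \<in> carrier G" "m \<preceq> x" "m \<preceq> y"
    and "\<And>z. \<lbrakk>z \<in> carrier G; z \<preceq> x; z \<preceq> y\<rbrakk> \<Longrightarrow> z \<preceq> m"
  shows "x \<sqinter>\<^sub>G y = m"
  using assms by (meson le_antisym meet_closed meet_le1 meet_le2 meet_greatest)

lemma join_eqI:
  assumes "x \<in> carrier G" "y \<in> carrier G" "m \<in> carrier G" "x \<preceq> m" "y \<preceq> m"
    and "\<And>z. \<lbrakk>z \<in> carrier G; x \<preceq> z; y \<preceq> z\<rbrakk> \<Longrightarrow> m \<preceq> z"
  shows "x \<squnion>\<^sub>G y = m"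
  using assms by (meson le_antisym join_closed join_ge1 join_ge2 join_least)

lemma meet_absorb1: "\<lbrakk>x \<in> carrier G; y \<in> carrier G; x \<preceq> y\<rbrakk> \<Longrightarrow> x \<sqinter>\<^sub>G y = x"
  by (rule meet_eqI) auto

lemma meet_absorb2: "\<lbrakk>x \<in> carrier G; y \<in> carrier G; y \<preceq> x\<rbrakk> \<Longrightarrow> x \<sqinter>\<^sub>G y = y"
  by (rule meet_eqI) auto

lemma mult_mono:
  assumes "x \<preceq> y" "z \<preceq> w" "x \<in> carrier G" "y \<in> carrier G" "z \<in> carrier G" "w \<in> carrier G"
  shows "x \<otimes> z \<preceq> y \<otimes> w"
  using le_trans[OF mult_right_mono[of x y z] mult_left_mono[of z w y]] assms by simp

text \<open>Stated for products nested to the right, the form in which \<open>m_assoc\<close> leaves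
  them.\<close>

lemma inv_mult_cancel:
  "\<lbrakk>x \<in> carrier G; y \<in> carrier G\<rbrakk> \<Longrightarrow> inv x \<otimes> (x \<otimes> y) = y"
  "\<lbrakk>x \<in> carrier G; y \<in> carrier G\<rbrakk> \<Longrightarrow> x \<otimes> (inv x \<otimes> y) = y"
  by (simp_all flip: m_assoc)

lemma mult_left_le_iff:
  "\<lbrakk>x \<in> carrier G; y \<in> carrier G; z \<in> carrier G\<rbrakk> \<Longrightarrow> z \<otimes> x \<preceq> z \<otimes> y \<longleftrightarrow> x \<preceq> y"
  using mult_left_mono[of "z \<otimes> x" "z \<otimes> y" "inv z"] mult_left_mono
  by (auto simp: inv_mult_cancel)

lemma mult_right_le_iff:
  "\<lbrakk>x \<in> carrier G; y \<in> carrier G; z \<in> carrier G\<rbrakk> \<Longrightarrow> x \<otimes> z \<preceq> y \<otimes> z \<longleftrightarrow> x \<preceq> y"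
  using mult_right_mono[of "x \<otimes> z" "y \<otimes> z" "inv z"] mult_right_mono
  by (auto simp: m_assoc)

lemma le_iff_quotient:
  "\<lbrakk>x \<in> carrier G; y \<in> carrier G\<rbrakk> \<Longrightarrow> x \<preceq> y \<longleftrightarrow> \<one> \<preceq> inv x \<otimes> y"
  using mult_left_le_iff[of x y "inv x"] by simp

lemma le_inv_mult_iff:
  "\<lbrakk>x \<in> carrier G; y \<in> carrier G; z \<in> carrier G\<rbrakk> \<Longrightarrow> x \<preceq> inv z \<otimes> y \<longleftrightarrow> z \<otimes> x \<preceq> y"
  using mult_left_le_iff[of "x" "inv z \<otimes> y" "z"] by (simp add: inv_mult_cancel)

lemma le_mult_inv_iff:
  "\<lbrakk>x \<in> carrier G; y \<in> carrier G; z \<in> carrier G\<rbrakk> \<Longrightarrow> x \<preceq> y \<otimes> inv z \<longleftrightarrow> x \<otimes> z \<preceq> y"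
  using mult_right_le_iff[of "x" "y \<otimes> inv z" "z"] by (simp add: m_assoc)

lemma inv_antimono:
  assumes "x \<preceq> y" "x \<in> carrier G" "y \<in> carrier G"
  shows "inv y \<preceq> inv x"
  \<comment> \<open>Both \<open>inv y \<preceq> inv x\<close> and \<open>x \<preceq> y\<close>
    amount to \<open>x \<otimes> inv y \<preceq> \<one>\<close>.\<close>
  using assms le_inv_mult_iff[of "inv y" "\<one>" x] le_mult_inv_iff[of x \<one> "inv y"] by simp

text \<open>Left translation by \<open>z\<close> is an order automorphism, with left translation by
  \<open>inv z\<close> as inverse.\<close>

lemma mult_meet_distrib_left:
  assumes "x \<in> carrier G" "y \<in> carrier G" "z \<in> carrier G"
  shows "z \<otimes> (x \<sqinter>\<^sub>G y) = (z \<otimes> x) \<sqinter>\<^sub>G (z \<otimes> y)"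
proof (rule meet_eqI[symmetric])
  fix w assume "w \<in> carrier G" "w \<preceq> z \<otimes> x" "w \<preceq> z \<otimes> y"
  then show "w \<preceq> z \<otimes> (x \<sqinter>\<^sub>G y)"
    using assms le_inv_mult_iff[of w _ "inv z"]
    by (metis inv_closed inv_inv m_closed meet_closed meet_greatest)
qed (use assms in \<open>auto intro: mult_left_mono meet_le1 meet_le2 meet_closed\<close>)

text \<open>Left translation by \<open>g\<close> carries the join of \<open>inv g\<close> and
  \<open>\<one>\<close> to the join of \<open>\<one>\<close> and \<open>g\<close>; these are the
  negative and the positive part of \<open>g\<close>.\<close>

lemma positive_quotient:
  assumes "g \<in> carrier G"
  shows "g = (g \<squnion>\<^sub>G \<one>) \<otimes> inv (inv g \<squnion>\<^sub>G \<one>)"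
proof -
  have "g \<otimes> (inv g \<squnion>\<^sub>G \<one>) = g \<squnion>\<^sub>G \<one>"
  proof (rule join_eqI[symmetric])
    show "g \<preceq> g \<otimes> (inv g \<squnion>\<^sub>G \<one>)"
      using assms mult_left_mono[of \<one> "inv g \<squnion>\<^sub>G \<one>" g] by (simp add: join_closed join_ge2)
    show "\<one> \<preceq> g \<otimes> (inv g \<squnion>\<^sub>G \<one>)"
      using assms mult_left_mono[of "inv g" "inv g \<squnion>\<^sub>G \<one>" g] by (simp add: join_closed join_ge1)
    fix z assume "z \<in> carrier G" "g \<preceq> z" "\<one> \<preceq> z"
    then have "inv g \<squnion>\<^sub>G \<one> \<preceq> inv g \<otimes> z"
      using assms by (intro join_least) (auto simp: le_inv_mult_iff)
    then show "g \<otimes> (inv g \<squnion>\<^sub>G \<one>) \<preceq> z"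
      using assms \<open>z \<in> carrier G\<close> by (simp add: le_inv_mult_iff join_closed)
  qed (use assms join_closed in auto)
  then show ?thesis using assms by (metis inv_closed inv_solve_right' join_closed one_closed)
qed

text \<open>The common multiple is the join. Dividing it on the left by either element leaves a
  positive cofactor.\<close>

lemma common_right_multiple:
  assumes "x \<in> carrier G" "y \<in> carrier G"
  obtains p q where "p \<in> carrier G" "q \<in> carrier G" "\<one> \<preceq> p" "\<one> \<preceq> q" "x \<otimes> p = y \<otimes> q"
proof
  show "inv x \<otimes> (x \<squnion>\<^sub>G y) \<in> carrier G" "inv y \<otimes> (x \<squnion>\<^sub>G y) \<in> carrier G"
    using assms by (auto simp: join_closed)
  show "\<one> \<preceq> inv x \<otimes> (x \<squnion>\<^sub>G y)" "\<one> \<preceq> inv y \<otimes> (x \<squnion>\<^sub>G y)"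
    using assms by (auto simp: join_closed join_ge1 join_ge2 le_inv_mult_iff)
  show "x \<otimes> (inv x \<otimes> (x \<squnion>\<^sub>G y)) = y \<otimes> (inv y \<otimes> (x \<squnion>\<^sub>G y))"
    using assms by (simp add: join_closed inv_mult_cancel)
qed

end

section \<open>Isomorphisms determined by the order and by the positive cone\<close>

text \<open>Joins and meets are fixed by the order. Surjectivity enters because the competing bounds
  range over all of \<open>K\<close> and must be pulled back to \<open>G\<close>.\<close>

lemma lgroup_isomorphic_if_order_iso:
  assumes "lgroup G" "lgroup K" "h \<in> iso G K"
    and le: "\<And>x y. \<lbrakk>x \<in> carrier G; y \<in> carrier G\<rbrakk> \<Longrightarrow> h x \<preceq>\<^bsub>K\<^esub> h y \<longleftrightarrow> x \<preceq>\<^bsub>G\<^esub> y"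
  shows "lgroup_isomorphic G K"
proof -
  interpret G: lgroup G by fact
  interpret K: lgroup K by fact
  have bij: "bij_betw h (carrier G) (carrier K)" using assms(3) by (simp add: iso_def)
  then have cl: "h x \<in> carrier K" if "x \<in> carrier G" for x using that by (auto simp: bij_betw_def)
  have surj: "\<exists>x \<in> carrier G. h x = y" if "y \<in> carrier K" for y
    using that bij_betw_imp_surj_on[OF bij] by (metis imageE)
  have "join_pres (order_of G) (order_of K) h"
    unfolding join_pres_def
  proof (simp add: G.lattice_order K.lattice_order, intro ballI)
    fix x y assume "x \<in> carrier G" "y \<in> carrier G"
    then show "h (G.ljoin x y) = K.ljoin (h x) (h y)"
      by (intro K.join_eqI[symmetric])
        (auto simp: cl le G.join_closed G.join_ge1 G.join_ge2 G.join_least dest!: surj)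
  qed
  moreover have "meet_pres (order_of G) (order_of K) h"
    unfolding meet_pres_def
  proof (simp add: G.lattice_order K.lattice_order, intro ballI)
    fix x y assume "x \<in> carrier G" "y \<in> carrier G"
    then show "h (G.lmeet x y) = K.lmeet (h x) (h y)"
      by (intro K.meet_eqI[symmetric])
        (auto simp: cl le G.meet_closed G.meet_le1 G.meet_le2 G.meet_greatest dest!: surj)
  qed
  ultimately show ?thesis using assms(3) unfolding lgroup_isomorphic_def by blast
qed

definition pos_cone :: "('a, 'm) ordered_monoid_scheme \<Rightarrow> 'a set"
  where "pos_cone G = {x \<in> carrier G. \<one>\<^bsub>G\<^esub> \<preceq>\<^bsub>G\<^esub> x}"

lemma (in lgroup) pos_cone_mult: "\<lbrakk>x \<in> pos_cone G; y \<in> pos_cone G\<rbrakk> \<Longrightarrow> x \<otimes> y \<in> pos_cone G"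
  using mult_mono[of \<one> x \<one> y] by (simp add: pos_cone_def)

text \<open>Every element is a quotient of positive ones, and common right multiples (as in Ore's
  condition) make the extension of \<open>\<phi>\<close> to quotients well defined.\<close>

lemma pos_cone_iso_extends:
  assumes "lgroup G" "lgroup K"
    and bij: "bij_betw \<phi> (pos_cone G) (pos_cone K)"
    and mult: "\<And>x y. \<lbrakk>x \<in> pos_cone G; y \<in> pos_cone G\<rbrakk> \<Longrightarrow> \<phi> (x \<otimes>\<^bsub>G\<^esub> y) = \<phi> x \<otimes>\<^bsub>K\<^esub> \<phi> y"
  shows "lgroup_isomorphic G K"
proof -
  interpret G: lgroup G by fact
  interpret K: lgroup K by fact
  have cG: "x \<in> carrier G" if "x \<in> pos_cone G" for x using that by (simp add: pos_cone_def)
  have pK: "\<phi> x \<in> pos_cone K" if "x \<in> pos_cone G" for x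
    using that bij by (auto simp: bij_betw_def)
  then have cK: "\<phi> x \<in> carrier K" if "x \<in> pos_cone G" for x using that by (simp add: pos_cone_def)
  have one: "\<one>\<^bsub>G\<^esub> \<in> pos_cone G" "\<one>\<^bsub>K\<^esub> \<in> pos_cone K" by (simp_all add: pos_cone_def)
  have phi_one: "\<phi> \<one>\<^bsub>G\<^esub> = \<one>\<^bsub>K\<^esub>"
    using mult[OF one(1) one(1)] cK[OF one(1)] by simp
  have quot: "\<exists>a b. a \<in> pos_cone G \<and> b \<in> pos_cone G \<and> g = a \<otimes>\<^bsub>G\<^esub> inv\<^bsub>G\<^esub> b"
    if "g \<in> carrier G" for g
    using G.positive_quotient[OF that] that
    by (intro exI[of _ "G.ljoin g \<one>\<^bsub>G\<^esub>"] exI[of _ "G.ljoin (inv\<^bsub>G\<^esub> g) \<one>\<^bsub>G\<^esub>"])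
      (auto simp: pos_cone_def G.join_closed G.join_ge2)
  have quotK: "\<exists>a b. a \<in> pos_cone K \<and> b \<in> pos_cone K \<and> g = a \<otimes>\<^bsub>K\<^esub> inv\<^bsub>K\<^esub> b"
    if "g \<in> carrier K" for g
    using K.positive_quotient[OF that] that
    by (intro exI[of _ "K.ljoin g \<one>\<^bsub>K\<^esub>"] exI[of _ "K.ljoin (inv\<^bsub>K\<^esub> g) \<one>\<^bsub>K\<^esub>"])
      (auto simp: pos_cone_def K.join_closed K.join_ge2)
  have multiple: "\<exists>p q. p \<in> pos_cone G \<and> q \<in> pos_cone G \<and> x \<otimes>\<^bsub>G\<^esub> p = y \<otimes>\<^bsub>G\<^esub> q"
    if "x \<in> pos_cone G" "y \<in> pos_cone G" for x y
    by (rule G.common_right_multiple[OF cG cG, OF that]) (auto simp: pos_cone_def)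
  have welldef: "\<phi> a \<otimes>\<^bsub>K\<^esub> inv\<^bsub>K\<^esub> \<phi> b = \<phi> c \<otimes>\<^bsub>K\<^esub> inv\<^bsub>K\<^esub> \<phi> d"
    if P: "a \<in> pos_cone G" "b \<in> pos_cone G" "c \<in> pos_cone G" "d \<in> pos_cone G"
      and eq: "a \<otimes>\<^bsub>G\<^esub> inv\<^bsub>G\<^esub> b = c \<otimes>\<^bsub>G\<^esub> inv\<^bsub>G\<^esub> d" for a b c d
  proof -
    \<comment> \<open>Extending both denominators to the common value \<open>b p = d q\<close>
      forces the numerators to agree, \<open>a p = c q\<close>. The images under
      \<open>\<phi>\<close> satisfy the same two identities, and the cofactors cancel in
      \<open>K\<close>.\<close>
    obtain p q where pq: "p \<in> pos_cone G" "q \<in> pos_cone G" "b \<otimes>\<^bsub>G\<^esub> p = d \<otimes>\<^bsub>G\<^esub> q"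
      using multiple P by meson
    note cs = P[THEN cG] pq(1,2)[THEN cG]
    have "a \<otimes>\<^bsub>G\<^esub> p = (a \<otimes>\<^bsub>G\<^esub> inv\<^bsub>G\<^esub> b) \<otimes>\<^bsub>G\<^esub> (b \<otimes>\<^bsub>G\<^esub> p)"
      using cs by (simp add: G.m_assoc G.inv_mult_cancel)
    also have "\<dots> = c \<otimes>\<^bsub>G\<^esub> q"
      unfolding eq pq(3) using cs by (simp add: G.m_assoc G.inv_mult_cancel)
    finally have ac: "\<phi> a \<otimes>\<^bsub>K\<^esub> \<phi> p = \<phi> c \<otimes>\<^bsub>K\<^esub> \<phi> q"
      using mult P pq by metis
    have bd: "\<phi> b \<otimes>\<^bsub>K\<^esub> \<phi> p = \<phi> d \<otimes>\<^bsub>K\<^esub> \<phi> q" using mult P pq by metis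
    note cs = P[THEN cK] pq(1,2)[THEN cK]
    have "\<phi> a \<otimes>\<^bsub>K\<^esub> inv\<^bsub>K\<^esub> \<phi> b = (\<phi> a \<otimes>\<^bsub>K\<^esub> \<phi> p) \<otimes>\<^bsub>K\<^esub> inv\<^bsub>K\<^esub> (\<phi> b \<otimes>\<^bsub>K\<^esub> \<phi> p)"
      using cs by (simp add: K.inv_mult_group K.m_assoc K.inv_mult_cancel)
    also have "\<dots> = \<phi> c \<otimes>\<^bsub>K\<^esub> inv\<^bsub>K\<^esub> \<phi> d"
      unfolding ac bd using cs by (simp add: K.inv_mult_group K.m_assoc K.inv_mult_cancel)
    finally show ?thesis .
  qed
  \<comment> \<open>One representation is fixed, by the positive and negative parts;
    \<open>welldef\<close> makes every other one equally good.\<close>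
  define h where "h g = \<phi> (G.ljoin g \<one>\<^bsub>G\<^esub>) \<otimes>\<^bsub>K\<^esub> inv\<^bsub>K\<^esub> \<phi> (G.ljoin (inv\<^bsub>G\<^esub> g) \<one>\<^bsub>G\<^esub>)" for g
  have h: "h (a \<otimes>\<^bsub>G\<^esub> inv\<^bsub>G\<^esub> b) = \<phi> a \<otimes>\<^bsub>K\<^esub> inv\<^bsub>K\<^esub> \<phi> b"
    if "a \<in> pos_cone G" "b \<in> pos_cone G" for a b
    unfolding h_def
  proof (rule welldef)
    have "a \<otimes>\<^bsub>G\<^esub> inv\<^bsub>G\<^esub> b \<in> carrier G" using that cG by simp
    then show "G.ljoin (a \<otimes>\<^bsub>G\<^esub> inv\<^bsub>G\<^esub> b) \<one>\<^bsub>G\<^esub> \<in> pos_cone G"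
      "G.ljoin (inv\<^bsub>G\<^esub> (a \<otimes>\<^bsub>G\<^esub> inv\<^bsub>G\<^esub> b)) \<one>\<^bsub>G\<^esub> \<in> pos_cone G"
      "G.ljoin (a \<otimes>\<^bsub>G\<^esub> inv\<^bsub>G\<^esub> b) \<one>\<^bsub>G\<^esub> \<otimes>\<^bsub>G\<^esub>
        inv\<^bsub>G\<^esub> (G.ljoin (inv\<^bsub>G\<^esub> (a \<otimes>\<^bsub>G\<^esub> inv\<^bsub>G\<^esub> b)) \<one>\<^bsub>G\<^esub>) = a \<otimes>\<^bsub>G\<^esub> inv\<^bsub>G\<^esub> b"
      using G.positive_quotient by (simp_all add: pos_cone_def G.join_closed G.join_ge2)
  qed (use that in auto)
  have h_pos: "h a = \<phi> a" if "a \<in> pos_cone G" for a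
    using h[OF that one(1)] that cG cK by (simp add: phi_one)
  have closed: "h g \<in> carrier K" if g: "g \<in> carrier G" for g
    using quot[OF g] cK h by force
  have hom: "h (g \<otimes>\<^bsub>G\<^esub> g') = h g \<otimes>\<^bsub>K\<^esub> h g'" if g: "g \<in> carrier G" "g' \<in> carrier G" for g g'
  proof -
    obtain a b c d where P: "a \<in> pos_cone G" "b \<in> pos_cone G" "c \<in> pos_cone G" "d \<in> pos_cone G"
      and g: "g = a \<otimes>\<^bsub>G\<^esub> inv\<^bsub>G\<^esub> b" "g' = c \<otimes>\<^bsub>G\<^esub> inv\<^bsub>G\<^esub> d"
      using quot g by metis
    \<comment> \<open>The inner factor \<open>inv b \<otimes> c\<close> becomes
      \<open>p \<otimes> inv q\<close>, so that the product of two quotients is again a single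
      quotient of positive elements.\<close>
    obtain p q where pq: "p \<in> pos_cone G" "q \<in> pos_cone G" "b \<otimes>\<^bsub>G\<^esub> p = c \<otimes>\<^bsub>G\<^esub> q"
      using multiple P by meson
    note cs = P[THEN cG] pq(1,2)[THEN cG]
    have "inv\<^bsub>G\<^esub> b \<otimes>\<^bsub>G\<^esub> c = p \<otimes>\<^bsub>G\<^esub> inv\<^bsub>G\<^esub> q"
    proof -
      have "inv\<^bsub>G\<^esub> b \<otimes>\<^bsub>G\<^esub> c = inv\<^bsub>G\<^esub> b \<otimes>\<^bsub>G\<^esub> (c \<otimes>\<^bsub>G\<^esub> q) \<otimes>\<^bsub>G\<^esub> inv\<^bsub>G\<^esub> q"
        using cs by (simp add: G.m_assoc)
      then show ?thesis unfolding pq(3)[symmetric] using cs by (simp add: G.inv_mult_cancel)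
    qed
    then have "g \<otimes>\<^bsub>G\<^esub> g' = a \<otimes>\<^bsub>G\<^esub> (p \<otimes>\<^bsub>G\<^esub> inv\<^bsub>G\<^esub> q) \<otimes>\<^bsub>G\<^esub> inv\<^bsub>G\<^esub> d"
      unfolding g using cs by (metis G.inv_closed G.m_assoc G.m_closed)
    also have "\<dots> = (a \<otimes>\<^bsub>G\<^esub> p) \<otimes>\<^bsub>G\<^esub> inv\<^bsub>G\<^esub> (d \<otimes>\<^bsub>G\<^esub> q)"
      using cs by (simp add: G.inv_mult_group G.m_assoc)
    finally have gg': "h (g \<otimes>\<^bsub>G\<^esub> g') = \<phi> a \<otimes>\<^bsub>K\<^esub> \<phi> p \<otimes>\<^bsub>K\<^esub> inv\<^bsub>K\<^esub> (\<phi> d \<otimes>\<^bsub>K\<^esub> \<phi> q)"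
      using h P pq mult G.pos_cone_mult by simp
    note cs = P[THEN cK] pq(1,2)[THEN cK]
    have "\<phi> b \<otimes>\<^bsub>K\<^esub> \<phi> p = \<phi> c \<otimes>\<^bsub>K\<^esub> \<phi> q" using mult P pq by metis
    then have "inv\<^bsub>K\<^esub> \<phi> b \<otimes>\<^bsub>K\<^esub> (\<phi> c \<otimes>\<^bsub>K\<^esub> \<phi> q) = \<phi> p"
      using cs by (metis K.inv_mult_cancel(1))
    then have "\<phi> p = (inv\<^bsub>K\<^esub> \<phi> b \<otimes>\<^bsub>K\<^esub> \<phi> c) \<otimes>\<^bsub>K\<^esub> \<phi> q"
      using cs by (simp add: K.m_assoc)
    then have "h (g \<otimes>\<^bsub>G\<^esub> g') = \<phi> a \<otimes>\<^bsub>K\<^esub> (inv\<^bsub>K\<^esub> \<phi> b \<otimes>\<^bsub>K\<^esub> \<phi> c) \<otimes>\<^bsub>K\<^esub> inv\<^bsub>K\<^esub> \<phi> d"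
      unfolding gg' using cs by (simp add: K.inv_mult_group K.m_assoc K.inv_mult_cancel)
    then show ?thesis unfolding g h[OF P(1,2)] h[OF P(3,4)] using cs by (simp add: K.m_assoc)
  qed
  then have "h \<in> hom G K" using closed by (simp add: hom_def)
  then interpret hom: group_hom G K h by unfold_locales
  \<comment> \<open>If \<open>h g = \<phi> c\<close>, clearing the denominator gives
    \<open>\<phi> a = \<phi> (c b)\<close>. Injectivity of \<open>\<phi>\<close> yields
    \<open>a = c b\<close>, hence \<open>g = c\<close>.\<close>
  have reflect: "g \<in> pos_cone G" if g: "g \<in> carrier G" "h g \<in> pos_cone K" for g
  proof -
    obtain a b where ab: "a \<in> pos_cone G" "b \<in> pos_cone G" "g = a \<otimes>\<^bsub>G\<^esub> inv\<^bsub>G\<^esub> b"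
      using quot g by blast
    obtain c where c: "c \<in> pos_cone G" "h g = \<phi> c"
      using g(2) bij by (auto simp: bij_betw_def)
    have "\<phi> a = \<phi> c \<otimes>\<^bsub>K\<^esub> \<phi> b"
      using c(2) h[OF ab(1,2)] ab c(1) cK by (metis K.inv_solve_right' closed g(1))
    then have "a = c \<otimes>\<^bsub>G\<^esub> b"
      using mult[OF c(1) ab(2)] G.pos_cone_mult[OF c(1) ab(2)] bij ab(1)
      by (metis bij_betw_imp_inj_on inj_onD)
    then show ?thesis using ab c cG by (simp add: G.m_assoc)
  qed
  have "inj_on h (carrier G)"
  proof (rule inj_onI)
    fix x y assume xy: "x \<in> carrier G" "y \<in> carrier G" "h x = h y"
    define g where "g = inv\<^bsub>G\<^esub> x \<otimes>\<^bsub>G\<^esub> y"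
    have g: "g \<in> carrier G" "h g = \<one>\<^bsub>K\<^esub>" using xy by (simp_all add: g_def closed)
    \<comment> \<open>An element of the kernel is positive by \<open>reflect\<close>, and on
      positive elements \<open>h\<close> is the injective \<open>\<phi>\<close>.\<close>
    have "g \<in> pos_cone G" using g reflect one by simp
    then have "g = \<one>\<^bsub>G\<^esub>" using g h_pos phi_one one bij by (metis bij_betw_imp_inj_on inj_onD)
    then show "x = y" using xy by (simp add: g_def G.inv_solve_left')
  qed
  moreover have "h ` carrier G = carrier K"
  proof
    show "carrier K \<subseteq> h ` carrier G"
    proof
      fix y assume "y \<in> carrier K"
      then obtain a b where "a \<in> pos_cone K" "b \<in> pos_cone K" "y = a \<otimes>\<^bsub>K\<^esub> inv\<^bsub>K\<^esub> b"
        using quotK by blast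
      moreover have "pos_cone K = \<phi> ` pos_cone G" using bij by (simp add: bij_betw_def)
      ultimately obtain a' b' where "a' \<in> pos_cone G" "b' \<in> pos_cone G"
        "y = \<phi> a' \<otimes>\<^bsub>K\<^esub> inv\<^bsub>K\<^esub> \<phi> b'" by auto
      then show "y \<in> h ` carrier G" using h cG
        by (metis G.inv_closed G.m_closed image_eqI)
    qed
  qed (use closed in blast)
  ultimately have "h \<in> iso G K" using \<open>h \<in> hom G K\<close> by (simp add: iso_def bij_betw_def)
  moreover have "h x \<preceq>\<^bsub>K\<^esub> h y \<longleftrightarrow> x \<preceq>\<^bsub>G\<^esub> y" if "x \<in> carrier G" "y \<in> carrier G" for x y
  proof -
    let ?g = "inv\<^bsub>G\<^esub> x \<otimes>\<^bsub>G\<^esub> y"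
    have g: "?g \<in> carrier G" using that by simp
    then have "h ?g \<in> pos_cone K \<longleftrightarrow> ?g \<in> pos_cone G"
      using reflect h_pos pK by metis
    moreover have "h ?g = inv\<^bsub>K\<^esub> h x \<otimes>\<^bsub>K\<^esub> h y" using that by simp
    ultimately show ?thesis
      using G.le_iff_quotient[OF that] K.le_iff_quotient[OF closed closed, OF that] g closed[OF g]
      by (simp add: pos_cone_def)
  qed
  ultimately show ?thesis using lgroup_isomorphic_if_order_iso assms(1,2) by blast
qed

section \<open>Intervals in lexicographic products\<close>

text \<open>The meet is a Hilbert choice among greatest lower bounds, so its value is settled once
  \<open>m\<close> is one of them and antisymmetry holds at \<open>m\<close>. This form applies to
  \<open>lex_prod\<close>, where no lattice structure has been established.\<close>

lemma order_of_meet_eqI: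
  assumes "x \<in> carrier P" "y \<in> carrier P" "m \<in> carrier P" "m \<preceq>\<^bsub>P\<^esub> x" "m \<preceq>\<^bsub>P\<^esub> y"
    and greatest: "\<And>z. \<lbrakk>z \<in> carrier P; z \<preceq>\<^bsub>P\<^esub> x; z \<preceq>\<^bsub>P\<^esub> y\<rbrakk> \<Longrightarrow> z \<preceq>\<^bsub>P\<^esub> m"
    and antisym: "\<And>z. \<lbrakk>z \<in> carrier P; z \<preceq>\<^bsub>P\<^esub> m; m \<preceq>\<^bsub>P\<^esub> z\<rbrakk> \<Longrightarrow> z = m"
  shows "x \<sqinter>\<^bsub>order_of P\<^esub> y = m"
  unfolding meet_def inf_def
  by (rule some_equality)
    (use assms in \<open>auto simp: greatest_def Lower_def intro!: greatest antisym\<close>)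

lemma group_real_lgroup: "group real_lgroup"
  by (rule groupI) (auto simp: real_lgroup_def intro: exI[of _ "- _"])

lemma inv_real_lgroup: "inv\<^bsub>real_lgroup\<^esub> x = - x"
  by (rule group.inv_equality[OF group_real_lgroup]) (simp_all add: real_lgroup_def)

locale real_subgroup =
  fixes H :: "real set"
  assumes subgroup: "subgroup H real_lgroup" and one_mem: "1 \<in> H"
begin

lemma add_mem: "\<lbrakk>s \<in> H; t \<in> H\<rbrakk> \<Longrightarrow> s + t \<in> H"
  using subgroup.m_closed[OF subgroup] by (simp add: real_lgroup_def)

lemma zero_mem: "0 \<in> H"
  using subgroup.one_closed[OF subgroup] by (simp add: real_lgroup_def)

lemma minus_mem: "t \<in> H \<Longrightarrow> - t \<in> H"
  using subgroup.m_inv_closed[OF subgroup] by (simp add: inv_real_lgroup)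

lemma diff_mem: "\<lbrakk>s \<in> H; t \<in> H\<rbrakk> \<Longrightarrow> s - t \<in> H"
  using add_mem[OF _ minus_mem] by force

end

locale lex_interval = lgroup G + real_subgroup H for G (structure) and H +
  fixes b
  assumes b_closed: "b \<in> carrier G"
begin

abbreviation lex where "lex \<equiv> lex_prod (real_lgroup\<lparr>carrier := H\<rparr>) G"
abbreviation \<Gamma> where "\<Gamma> \<equiv> Gamma lex (1, b)"

lemma carrier_lex: "carrier lex = H \<times> carrier G"
  by (simp add: lex_prod_def real_lgroup_def)

lemma mult_lex: "(s, g) \<otimes>\<^bsub>lex\<^esub> (t, h) = (s + t, g \<otimes> h)"
  by (simp add: lex_prod_def real_lgroup_def DirProd_def)

lemma one_lex: "\<one>\<^bsub>lex\<^esub> = (0, \<one>)"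
  by (simp add: lex_prod_def real_lgroup_def DirProd_def)

lemma le_lex: "(s, g) \<preceq>\<^bsub>lex\<^esub> (t, h) \<longleftrightarrow> s < t \<or> s = t \<and> g \<preceq> h"
  by (auto simp: lex_prod_def real_lgroup_def)

lemma inv_lex:
  assumes "t \<in> H" "g \<in> carrier G"
  shows "inv\<^bsub>lex\<^esub> (t, g) = (- t, inv g)"
  \<comment> \<open>The inverse is taken as a definite description, since \<open>lex\<close> has not
    been shown to be a group.\<close>
  unfolding m_inv_def[of lex]
proof (rule the_equality)
  fix y assume y: "y \<in> carrier lex \<and> (t, g) \<otimes>\<^bsub>lex\<^esub> y = \<one>\<^bsub>lex\<^esub> \<and> y \<otimes>\<^bsub>lex\<^esub> (t, g) = \<one>\<^bsub>lex\<^esub>"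
  obtain s h where "y = (s, h)" by fastforce
  with y assms inv_equality[of h g] show "y = (- t, inv g)"
    by (auto simp: carrier_lex mult_lex one_lex)
qed (use assms in \<open>auto simp: carrier_lex mult_lex one_lex minus_mem\<close>)

text \<open>The first coordinates are linearly ordered, so a genuine meet in \<open>G\<close> arises
  only when they agree.\<close>

lemma meet_lex:
  assumes "s \<in> H" "t \<in> H" "g \<in> carrier G" "h \<in> carrier G"
  shows "(s, g) \<sqinter>\<^bsub>order_of lex\<^esub> (t, h) =
    (if s < t then (s, g) else if t < s then (t, h) else (s, g \<sqinter>\<^sub>G h))" (is "_ = ?m")
proof (rule order_of_meet_eqI)
  show "?m \<in> carrier lex" using assms by (simp add: carrier_lex meet_closed)
  show "?m \<preceq>\<^bsub>lex\<^esub> (s, g)" "?m \<preceq>\<^bsub>lex\<^esub> (t, h)"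
    using assms by (auto simp: le_lex meet_le1 meet_le2)
  show "z \<preceq>\<^bsub>lex\<^esub> ?m" if "z \<in> carrier lex" "z \<preceq>\<^bsub>lex\<^esub> (s, g)" "z \<preceq>\<^bsub>lex\<^esub> (t, h)" for z
    using that assms by (cases z) (auto simp: le_lex carrier_lex meet_greatest)
  show "z = ?m" if "z \<in> carrier lex" "z \<preceq>\<^bsub>lex\<^esub> ?m" "?m \<preceq>\<^bsub>lex\<^esub> z" for z
    using that assms
    by (cases z) (auto simp: le_lex carrier_lex meet_closed split: if_splits intro: le_antisym)
qed (use assms in \<open>simp_all add: carrier_lex\<close>)

lemma mem_interval:
  "(t, g) \<in> carrier \<Gamma> \<longleftrightarrow>
    t \<in> H \<and> g \<in> carrier G \<and> (0 < t \<or> t = 0 \<and> \<one> \<preceq> g) \<and> (t < 1 \<or> t = 1 \<and> g \<preceq> b)"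
  by (auto simp: Gamma_def carrier_lex one_lex le_lex)

lemma psum_interval:
  assumes "s \<in> H" "t \<in> H" "g \<in> carrier G" "h \<in> carrier G"
  shows "(s, g) \<oplus>\<^bsub>\<Gamma>\<^esub> (t, h) =
    (if s + t < 1 then (s + t, g \<otimes> h) else if s + t = 1 then (1, (g \<otimes> h) \<sqinter>\<^sub>G b) else (1, b))"
  using assms b_closed by (auto simp: Gamma_def mult_lex meet_lex add_mem one_mem)

lemma lneg_interval: "\<lbrakk>t \<in> H; g \<in> carrier G\<rbrakk> \<Longrightarrow> lneg \<Gamma> (t, g) = (1 - t, b \<otimes> inv g)"
  by (simp add: Gamma_def mult_lex inv_lex)

lemma rneg_interval: "\<lbrakk>t \<in> H; g \<in> carrier G\<rbrakk> \<Longrightarrow> rneg \<Gamma> (t, g) = (1 - t, inv g \<otimes> b)"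
  by (simp add: Gamma_def mult_lex inv_lex)

lemma pzero_interval: "pzero \<Gamma> = (0, \<one>)"
  by (simp add: Gamma_def one_lex)

lemma pone_interval: "pone \<Gamma> = (1, b)"
  by (simp add: Gamma_def)

end

section \<open>Infinitesimals and uniqueness of the representing group\<close>

primrec nfold :: "('a, 'm) pmv_scheme \<Rightarrow> nat \<Rightarrow> 'a \<Rightarrow> 'a" where
  "nfold M 0 x = pzero M"
| "nfold M (Suc n) x = nfold M n x \<oplus>\<^bsub>M\<^esub> x"

text \<open>Expressed by \<open>\<oplus>\<close>, zero and the top alone, hence preserved by every
  isomorphism. This recovers the layer of index 0 without reference to a grading.\<close>

definition infinitesimals :: "('a, 'm) pmv_scheme \<Rightarrow> 'a set"
  where "infinitesimals M = {x \<in> carrier M. \<forall>n. nfold M n x \<noteq> pone M}"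

lemma (in pseudo_mv_algebra) nfold_closed: "x \<in> carrier M \<Longrightarrow> nfold M n x \<in> carrier M"
  by (induction n) (auto simp: pzero_closed psum_closed)

lemma (in pseudo_mv_algebra) pmv_iso_infinitesimals:
  assumes F: "F \<in> pmv_iso M N" and x: "x \<in> carrier M"
  shows "F x \<in> infinitesimals N \<longleftrightarrow> x \<in> infinitesimals M"
proof -
  have inj: "inj_on F (carrier M)" and one: "F (pone M) = pone N" and cl: "F x \<in> carrier N"
    using F x by (auto simp: pmv_iso_def bij_betw_def)
  have "F (nfold M n x) = nfold N n (F x)" for n
    using F x nfold_closed by (induction n) (auto simp: pmv_iso_def)
  then have "nfold N n (F x) = pone N \<longleftrightarrow> nfold M n x = pone M" for n
    using one inj nfold_closed[OF x] pone_closed by (metis inj_onD)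
  then show ?thesis using x cl by (simp add: infinitesimals_def)
qed

text \<open>Sums of elements with first coordinate 0 keep that coordinate, whereas multiples of a
  positive real exceed 1.\<close>

lemma (in lex_interval) infinitesimals_interval:
  "infinitesimals \<Gamma> = {0} \<times> pos_cone G"
proof -
  have "(t, g) \<in> infinitesimals \<Gamma> \<longleftrightarrow> t = 0" if tg: "(t, g) \<in> carrier \<Gamma>" for t g
  proof
    have memb: "t \<in> H" "g \<in> carrier G" "0 \<le> t" using tg by (auto simp: mem_interval)
    {
      assume "t = 0"
      have "\<exists>h. nfold \<Gamma> n (t, g) = (0, h) \<and> h \<in> carrier G" for n
      proof (induction n)
        case (Suc n)
        then show ?case using \<open>t = 0\<close> memb zero_mem by (auto simp: psum_interval)
      qed (simp add: pzero_interval)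
      then have "nfold \<Gamma> n (t, g) \<noteq> pone \<Gamma>" for n
        by (metis fst_conv pone_interval zero_neq_one)
      then show "(t, g) \<in> infinitesimals \<Gamma>" using tg by (simp add: infinitesimals_def)
    }
    assume inf: "(t, g) \<in> infinitesimals \<Gamma>"
    \<comment> \<open>A sum with first coordinate beyond 1 is the top, which is excluded. The bound
      is \<open>\<le> 1\<close>, not strict: a sum landing exactly at 1 is truncated only in
      \<open>G\<close> and may still differ from the top.\<close>
    have "\<exists>h. nfold \<Gamma> n (t, g) = (n * t, h) \<and> h \<in> carrier G \<and> n * t \<in> H \<and> n * t \<le> 1" for n
    proof (induction n)
      case (Suc n)
      then obtain h where h: "nfold \<Gamma> n (t, g) = (n * t, h)" "h \<in> carrier G" "n * t \<in> H"
        by blast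
      have "nfold \<Gamma> (Suc n) (t, g) \<noteq> pone \<Gamma>"
        using inf unfolding infinitesimals_def by blast
      then show ?case
        using h memb b_closed add_mem[OF h(3), of t]
        by (auto simp: psum_interval pone_interval algebra_simps meet_closed split: if_splits)
    qed (simp add: pzero_interval zero_mem)
    then have "real n * t \<le> 1" for n by blast
    then show "t = 0"
      using \<open>0 \<le> t\<close> reals_Archimedean3[of t] by (metis linorder_not_le order_le_less)
  qed
  then have "(t, g) \<in> infinitesimals \<Gamma> \<longleftrightarrow> t = 0 \<and> g \<in> pos_cone G" for t g
    using mem_interval[of t g] by (auto simp: pos_cone_def zero_mem infinitesimals_def)
  then show ?thesis by auto
qed

text \<open>The map \<open>\<psi>\<close> is the second coordinate of the given isomorphism. At
  index 0 nothing is truncated, so \<open>\<oplus>\<close> becomes the group operation. Closure of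
  the infinitesimals is recorded because the inverse of such a \<open>\<psi>\<close> is later
  applied to a product.\<close>

lemma lex_represents_pos_cone:
  assumes "real_subgroup H" "pseudo_mv_algebra M" "lex_represents H M G b"
  shows "\<exists>\<psi>. bij_betw \<psi> (infinitesimals M) (pos_cone G) \<and>
    (\<forall>x \<in> infinitesimals M. \<forall>y \<in> infinitesimals M.
      x \<oplus>\<^bsub>M\<^esub> y \<in> infinitesimals M \<and> \<psi> (x \<oplus>\<^bsub>M\<^esub> y) = \<psi> x \<otimes>\<^bsub>G\<^esub> \<psi> y)"
proof -
  interpret M: pseudo_mv_algebra M by fact
  interpret G: lex_interval G H b
    using assms by (simp add: lex_interval_def lex_interval_axioms_def lex_represents_def)
  obtain F where F: "F \<in> pmv_iso M G.\<Gamma>" using assms(3) by (auto simp: lex_represents_def)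
  let ?I = "infinitesimals M"
  have carr: "x \<in> carrier M" if "x \<in> ?I" for x using that by (simp add: infinitesimals_def)
  have bij: "bij_betw F (carrier M) (carrier G.\<Gamma>)" using F by (simp add: pmv_iso_def)
  have image: "F ` ?I = {0} \<times> pos_cone G"
  proof
    show "F ` ?I \<subseteq> {0} \<times> pos_cone G"
      using M.pmv_iso_infinitesimals[OF F carr] G.infinitesimals_interval by blast
    show "{0} \<times> pos_cone G \<subseteq> F ` ?I"
    proof
      fix z assume z: "z \<in> {0::real} \<times> pos_cone G"
      then have inf: "z \<in> infinitesimals G.\<Gamma>" by (simp add: G.infinitesimals_interval)
      then have "z \<in> F ` carrier M"
        using bij_betw_imp_surj_on[OF bij] by (simp add: infinitesimals_def)
      then show "z \<in> F ` ?I" using inf M.pmv_iso_infinitesimals[OF F] by blast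
    qed
  qed
  have F_eq: "F x = (0, snd (F x)) \<and> snd (F x) \<in> pos_cone G" if "x \<in> ?I" for x
  proof -
    have "F x \<in> {0} \<times> pos_cone G" using image that by blast
    then show ?thesis by auto
  qed
  have "inj_on F ?I" using bij carr by (meson bij_betw_imp_inj_on inj_on_subset subsetI)
  then have "inj_on (snd \<circ> F) ?I"
    using F_eq unfolding inj_on_def comp_apply by metis
  moreover have "(snd \<circ> F) ` ?I = pos_cone G" by (simp only: image_comp[symmetric] image) simp
  ultimately have "bij_betw (snd \<circ> F) ?I (pos_cone G)" by (simp add: bij_betw_def)
  moreover have "x \<oplus>\<^bsub>M\<^esub> y \<in> ?I \<and> (snd \<circ> F) (x \<oplus>\<^bsub>M\<^esub> y) = (snd \<circ> F) x \<otimes>\<^bsub>G\<^esub> (snd \<circ> F) y"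
    if xy: "x \<in> ?I" "y \<in> ?I" for x y
  proof -
    have P: "snd (F x) \<in> pos_cone G" "snd (F y) \<in> pos_cone G" using F_eq xy by auto
    have "F (x \<oplus>\<^bsub>M\<^esub> y) = (0, snd (F x)) \<oplus>\<^bsub>G.\<Gamma>\<^esub> (0, snd (F y))"
      using F xy carr F_eq by (simp add: pmv_iso_def)
    also have "\<dots> = (0, snd (F x) \<otimes>\<^bsub>G\<^esub> snd (F y))"
      using P G.zero_mem by (simp add: G.psum_interval pos_cone_def)
    finally have eq: "F (x \<oplus>\<^bsub>M\<^esub> y) = (0, snd (F x) \<otimes>\<^bsub>G\<^esub> snd (F y))" .
    then have "F (x \<oplus>\<^bsub>M\<^esub> y) \<in> infinitesimals G.\<Gamma>"
      using P by (simp add: G.infinitesimals_interval G.pos_cone_mult)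
    then have "x \<oplus>\<^bsub>M\<^esub> y \<in> ?I"
      using M.pmv_iso_infinitesimals[OF F M.psum_closed] xy carr by blast
    then show ?thesis using eq by simp
  qed
  ultimately show ?thesis by blast
qed

text \<open>Both positive cones are copies of the one monoid \<open>infinitesimals M\<close>, so the
  composite through \<open>M\<close> is an isomorphism of cones.\<close>

lemma lex_represents_unique:
  assumes "real_subgroup H" "pseudo_mv_algebra M"
    and "lex_represents H M G1 b1" "lex_represents H M G2 b2"
  shows "lgroup_isomorphic G1 G2"
proof -
  let ?I = "infinitesimals M"
  obtain \<psi>1 where \<psi>1: "bij_betw \<psi>1 ?I (pos_cone G1)"
    "\<And>x y. \<lbrakk>x \<in> ?I; y \<in> ?I\<rbrakk> \<Longrightarrow> x \<oplus>\<^bsub>M\<^esub> y \<in> ?I \<and> \<psi>1 (x \<oplus>\<^bsub>M\<^esub> y) = \<psi>1 x \<otimes>\<^bsub>G1\<^esub> \<psi>1 y"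
    using lex_represents_pos_cone[OF assms(1-3)] by blast
  obtain \<psi>2 where \<psi>2: "bij_betw \<psi>2 ?I (pos_cone G2)"
    "\<And>x y. \<lbrakk>x \<in> ?I; y \<in> ?I\<rbrakk> \<Longrightarrow> x \<oplus>\<^bsub>M\<^esub> y \<in> ?I \<and> \<psi>2 (x \<oplus>\<^bsub>M\<^esub> y) = \<psi>2 x \<otimes>\<^bsub>G2\<^esub> \<psi>2 y"
    using lex_represents_pos_cone[OF assms(1,2,4)] by blast
  let ?inv = "inv_into ?I \<psi>1"
  have inv: "bij_betw ?inv (pos_cone G1) ?I" by (rule bij_betw_inv_into[OF \<psi>1(1)])
  show ?thesis
  proof (rule pos_cone_iso_extends)
    show "lgroup G1" "lgroup G2" using assms(3,4) by (simp_all add: lex_represents_def)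
    show "bij_betw (\<psi>2 \<circ> ?inv) (pos_cone G1) (pos_cone G2)"
      using bij_betw_trans[OF inv \<psi>2(1)] .
    fix x y assume "x \<in> pos_cone G1" "y \<in> pos_cone G1"
    then obtain x' y' where x': "x' \<in> ?I" "x = \<psi>1 x'" and y': "y' \<in> ?I" "y = \<psi>1 y'"
      using bij_betw_imp_surj_on[OF \<psi>1(1)] by blast
    have "?inv (\<psi>1 z) = z" if "z \<in> ?I" for z
      using \<psi>1(1) that by (simp add: bij_betw_inv_into_left)
    then show "(\<psi>2 \<circ> ?inv) (x \<otimes>\<^bsub>G1\<^esub> y) = (\<psi>2 \<circ> ?inv) x \<otimes>\<^bsub>G2\<^esub> (\<psi>2 \<circ> ?inv) y"
      using x' y' \<psi>1(2) \<psi>2(2) by (metis comp_apply)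
  qed
qed

text \<open>Needed to invert an isomorphism out of \<open>\<Gamma>\<close>, which has not been shown
  to satisfy the pseudo MV-axioms.\<close>

lemma (in lex_interval)
  shows psum_interval_closed:
      "\<lbrakk>x \<in> carrier \<Gamma>; y \<in> carrier \<Gamma>\<rbrakk> \<Longrightarrow> x \<oplus>\<^bsub>\<Gamma>\<^esub> y \<in> carrier \<Gamma>"
    and lneg_interval_closed: "x \<in> carrier \<Gamma> \<Longrightarrow> lneg \<Gamma> x \<in> carrier \<Gamma>"
    and rneg_interval_closed: "x \<in> carrier \<Gamma> \<Longrightarrow> rneg \<Gamma> x \<in> carrier \<Gamma>"
proof -
  show "x \<oplus>\<^bsub>\<Gamma>\<^esub> y \<in> carrier \<Gamma>" if "x \<in> carrier \<Gamma>" "y \<in> carrier \<Gamma>"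
  proof -
    obtain s g t h where "x = (s, g)" "y = (t, h)" by fastforce
    then show ?thesis
      using that b_closed mult_mono[of \<one> g \<one> h]
      by (auto simp: mem_interval psum_interval add_mem one_mem meet_closed meet_le2)
  qed
  show "lneg \<Gamma> x \<in> carrier \<Gamma>" if "x \<in> carrier \<Gamma>"
  proof -
    obtain t g where "x = (t, g)" by fastforce
    then show ?thesis
      using that b_closed mult_left_mono[of "inv g" \<one> b] inv_antimono[of \<one> g]
      by (auto simp: mem_interval lneg_interval diff_mem one_mem le_mult_inv_iff)
  qed
  show "rneg \<Gamma> x \<in> carrier \<Gamma>" if "x \<in> carrier \<Gamma>"
  proof -
    obtain t g where "x = (t, g)" by fastforce
    then show ?thesis
      using that b_closed mult_right_mono[of "inv g" \<one> b] inv_antimono[of \<one> g]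
      by (auto simp: mem_interval rneg_interval diff_mem one_mem le_inv_mult_iff)
  qed
qed

lemma Gamma_simps:
  "psum (Gamma G u) x y = (x \<otimes>\<^bsub>G\<^esub> y) \<sqinter>\<^bsub>order_of G\<^esub> u"
  "lneg (Gamma G u) x = u \<otimes>\<^bsub>G\<^esub> inv\<^bsub>G\<^esub> x"
  "rneg (Gamma G u) x = inv\<^bsub>G\<^esub> x \<otimes>\<^bsub>G\<^esub> u"
  "pzero (Gamma G u) = \<one>\<^bsub>G\<^esub>"
  "pone (Gamma G u) = u"
  by (simp_all add: Gamma_def)

lemma mem_carrier_Gamma:
  "x \<in> carrier (Gamma G u) \<longleftrightarrow> x \<in> carrier G \<and> \<one>\<^bsub>G\<^esub> \<preceq>\<^bsub>G\<^esub> x \<and> x \<preceq>\<^bsub>G\<^esub> u"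
  by (simp add: Gamma_def)

section \<open>The convex subgroup of an interval with a central grading\<close>

lemma mem_unit_interval_of: "t \<in> unit_interval_of H \<longleftrightarrow> 0 \<le> t \<and> t \<le> 1 \<and> t \<in> H"
  by (auto simp: unit_interval_of_def)

text \<open>A perfect algebra with a central system, moved into the group: \<open>S t\<close> and
  \<open>k t\<close> stand for the images of \<open>Ms t\<close> and \<open>c t\<close>. Additivity
  of \<open>k\<close> is stated with the untruncated group operation, and \<open>k 1\<close> may
  differ from \<open>u\<close>.\<close>

locale central_grading = lgroup G + real_subgroup H for G (structure) and H +
  fixes u :: 'a and S :: "real \<Rightarrow> 'a set" and k :: "real \<Rightarrow> 'a"
  assumes u_closed: "u \<in> carrier G"
    and S_interval: "\<lbrakk>t \<in> unit_interval_of H; x \<in> S t\<rbrakk> \<Longrightarrow> x \<in> carrier G \<and> \<one> \<preceq> x \<and> x \<preceq> u"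
    and S_cover: "\<lbrakk>x \<in> carrier G; \<one> \<preceq> x; x \<preceq> u\<rbrakk> \<Longrightarrow> \<exists>t \<in> unit_interval_of H. x \<in> S t"
    and S_disjoint:
      "\<lbrakk>s \<in> unit_interval_of H; t \<in> unit_interval_of H; x \<in> S s; x \<in> S t\<rbrakk> \<Longrightarrow> s = t"
    and S_less:
      "\<lbrakk>s \<in> unit_interval_of H; t \<in> unit_interval_of H; s < t; x \<in> S s; y \<in> S t\<rbrakk> \<Longrightarrow> x \<preceq> y"
    and S_lneg: "\<lbrakk>t \<in> unit_interval_of H; x \<in> S t\<rbrakk> \<Longrightarrow> u \<otimes> inv x \<in> S (1 - t)"
    and S_rneg: "\<lbrakk>t \<in> unit_interval_of H; x \<in> S t\<rbrakk> \<Longrightarrow> inv x \<otimes> u \<in> S (1 - t)"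
    and S_psum: "\<lbrakk>s \<in> unit_interval_of H; t \<in> unit_interval_of H; x \<in> S s; y \<in> S t\<rbrakk> \<Longrightarrow>
      (x \<otimes> y) \<sqinter>\<^sub>G u \<in> S (min (s + t) 1)"
    and k_mem: "t \<in> unit_interval_of H \<Longrightarrow> k t \<in> S t"
    and k_comm: "\<lbrakk>t \<in> unit_interval_of H; x \<in> carrier G\<rbrakk> \<Longrightarrow> k t \<otimes> x = x \<otimes> k t"
    and k_zero: "k 0 = \<one>"
    and k_add: "\<lbrakk>s \<in> unit_interval_of H; t \<in> unit_interval_of H; s + t \<le> 1\<rbrakk> \<Longrightarrow>
      k (s + t) = k s \<otimes> k t"
begin

abbreviation U where "U \<equiv> unit_interval_of H"

lemma U_facts [simp]: "0 \<in> U" "1 \<in> U" "t \<in> U \<Longrightarrow> 1 - t \<in> U"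
  by (auto simp: mem_unit_interval_of zero_mem one_mem diff_mem)

lemma S_closed: "\<lbrakk>t \<in> U; x \<in> S t\<rbrakk> \<Longrightarrow> x \<in> carrier G"
  and S_ge_one: "\<lbrakk>t \<in> U; x \<in> S t\<rbrakk> \<Longrightarrow> \<one> \<preceq> x"
  and S_le_u: "\<lbrakk>t \<in> U; x \<in> S t\<rbrakk> \<Longrightarrow> x \<preceq> u"
  using S_interval by blast+

lemma k_closed: "t \<in> U \<Longrightarrow> k t \<in> carrier G"
  using k_mem S_closed by blast

lemma one_mem_S0: "\<one> \<in> S 0"
  using k_mem[of 0] by (simp add: k_zero)

lemma u_mem_S1: "u \<in> S 1"
  using S_lneg[OF _ one_mem_S0] u_closed by simp

text \<open>The element \<open>z\<close> lies in some layer. If that layer has positive index, it is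
  above layer 0, so \<open>p \<preceq> z\<close> and therefore \<open>z = p\<close>.\<close>

lemma S0_convex:
  assumes "p \<in> S 0" "z \<in> carrier G" "\<one> \<preceq> z" "z \<preceq> p"
  shows "z \<in> S 0"
proof -
  have p: "p \<in> carrier G" "p \<preceq> u" using assms(1) S_interval[of 0 p] by auto
  then obtain t where t: "t \<in> U" "z \<in> S t"
    using S_cover[of z] assms le_trans[of z p u] u_closed by blast
  have "z = p" if "t \<noteq> 0"
    using that t S_less[of 0 t p z] assms p le_antisym[of z p] by (auto simp: mem_unit_interval_of zero_mem)
  then show ?thesis using t assms(1) by blast
qed

text \<open>The complement of \<open>y\<close> lies in layer 1, hence above \<open>x\<close>. So
  \<open>x \<otimes> y\<close> is below \<open>u\<close>, and the truncated sum is the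
  product.\<close>

lemma S0_mult:
  assumes "x \<in> S 0" "y \<in> S 0"
  shows "x \<otimes> y \<in> S 0"
proof -
  have cl: "x \<in> carrier G" "y \<in> carrier G" using S_closed[of 0] assms by auto
  have "x \<preceq> u \<otimes> inv y" using S_less[of 0 1 x] S_lneg[of 0 y] assms by simp
  then have "(x \<otimes> y) \<sqinter>\<^sub>G u = x \<otimes> y"
    using cl u_closed by (simp add: le_mult_inv_iff meet_absorb1)
  then show ?thesis using S_psum[of 0 0 x y] assms by simp
qed

text \<open>The convex subgroup generated by \<open>S 0\<close>. Two-sided bounds make convexity
  immediate, and no element has to be written as a quotient.\<close>

definition C where "C = {g \<in> carrier G. \<exists>p \<in> S 0. \<exists>q \<in> S 0. inv q \<preceq> g \<and> g \<preceq> p}"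

abbreviation GC where "GC \<equiv> G\<lparr>carrier := C\<rparr>"

lemma C_closed: "g \<in> C \<Longrightarrow> g \<in> carrier G"
  by (simp add: C_def)

lemma S0_subset_C: "p \<in> S 0 \<Longrightarrow> p \<in> C"
proof -
  assume p: "p \<in> S 0"
  then have "p \<in> carrier G" "inv \<one> \<preceq> p" "p \<preceq> p" using S_interval[of 0 p] by auto
  then show "p \<in> C" using p one_mem_S0 unfolding C_def by blast
qed

lemma C_pos_mem_S0: "\<lbrakk>g \<in> C; \<one> \<preceq> g\<rbrakk> \<Longrightarrow> g \<in> S 0"
  using S0_convex by (auto simp: C_def)

lemma C_convex:
  assumes "g \<in> C" "h \<in> C" "z \<in> carrier G" "g \<preceq> z" "z \<preceq> h"
  shows "z \<in> C"
proof -
  obtain p q where pq: "p \<in> S 0" "q \<in> S 0" "inv q \<preceq> g" "h \<preceq> p"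
    using assms by (auto simp: C_def)
  then have "p \<in> carrier G" "q \<in> carrier G" using S_closed[of 0] by auto
  then have "inv q \<preceq> z" "z \<preceq> p"
    using assms pq le_trans[of "inv q" g z] le_trans[of z h p] C_closed by auto
  then show ?thesis using pq assms by (auto simp: C_def)
qed

lemma C_mult:
  assumes "g \<in> C" "h \<in> C"
  shows "g \<otimes> h \<in> C"
proof -
  obtain p q p' q' where pq: "p \<in> S 0" "q \<in> S 0" "inv q \<preceq> g" "g \<preceq> p"
    "p' \<in> S 0" "q' \<in> S 0" "inv q' \<preceq> h" "h \<preceq> p'"
    using assms by (auto simp: C_def)
  then have cl: "p \<in> carrier G" "q \<in> carrier G" "p' \<in> carrier G" "q' \<in> carrier G"
    using S_closed[of 0] by auto
  have "inv (q' \<otimes> q) \<preceq> g \<otimes> h" "g \<otimes> h \<preceq> p \<otimes> p'"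
    using mult_mono[of "inv q" g "inv q'" h] mult_mono[of g p h p'] cl pq assms
    by (auto simp: C_closed inv_mult_group)
  then show ?thesis
    using S0_mult pq assms unfolding C_def by blast
qed

lemma C_inv:
  assumes "g \<in> C"
  shows "inv g \<in> C"
proof -
  obtain p q where pq: "p \<in> S 0" "q \<in> S 0" "inv q \<preceq> g" "g \<preceq> p"
    using assms by (auto simp: C_def)
  then have cl: "p \<in> carrier G" "q \<in> carrier G" using S_closed[of 0] by auto
  have "inv p \<preceq> inv g" "inv g \<preceq> q"
    using inv_antimono[of g p] inv_antimono[of "inv q" g] pq cl assms by (auto simp: C_closed)
  then show ?thesis using pq assms unfolding C_def by blast
qed

lemma subgroup_C: "subgroup C G"
proof (rule subgroupI)
  show "C \<noteq> {}" using S0_subset_C one_mem_S0 by blast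
qed (auto simp: C_closed C_mult C_inv)

text \<open>For positive \<open>p\<close> and \<open>p'\<close> the product
  \<open>p \<otimes> p'\<close> bounds both, so the join lies between \<open>g\<close> and an
  element of \<open>S 0\<close>; convexity does the rest.\<close>

lemma C_join:
  assumes "g \<in> C" "h \<in> C"
  shows "g \<squnion>\<^sub>G h \<in> C"
proof -
  obtain p p' where p: "p \<in> S 0" "g \<preceq> p" "p' \<in> S 0" "h \<preceq> p'"
    using assms by (auto simp: C_def)
  then have cl: "p \<in> carrier G" "p' \<in> carrier G" "\<one> \<preceq> p" "\<one> \<preceq> p'"
    using S_interval[of 0] by auto
  have "g \<preceq> p \<otimes> p'" "h \<preceq> p \<otimes> p'"
    using mult_mono[of g p \<one> p'] mult_mono[of \<one> p h p'] p cl assms by (auto simp: C_closed)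
  then show ?thesis
    using C_convex[of g "p \<otimes> p'" "g \<squnion>\<^sub>G h"] assms p cl S0_mult S0_subset_C C_closed
    by (simp add: join_closed join_ge1 join_least)
qed

text \<open>By duality under inversion: the inverse of the join of \<open>inv g\<close> and
  \<open>inv h\<close> bounds the meet from below.\<close>

lemma C_meet:
  assumes "g \<in> C" "h \<in> C"
  shows "g \<sqinter>\<^sub>G h \<in> C"
proof -
  have cl: "g \<in> carrier G" "h \<in> carrier G" using assms C_closed by auto
  define j where "j = inv g \<squnion>\<^sub>G inv h"
  have j: "j \<in> C" "j \<in> carrier G" using assms by (simp_all add: j_def C_join C_inv C_closed)
  have "inv j \<preceq> g" "inv j \<preceq> h"
    using inv_antimono[of "inv g" j] inv_antimono[of "inv h" j] cl j(2)
    by (auto simp: j_def join_ge1 join_ge2)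
  then show ?thesis
    using C_convex[of "inv j" g "g \<sqinter>\<^sub>G h"] j assms cl
    by (simp add: C_inv meet_closed meet_le1 meet_greatest)
qed

lemma lgroup_GC: "lgroup GC"
proof -
  interpret GC: group GC by (rule subgroup.subgroup_is_group[OF subgroup_C is_group])
  have "lattice (order_of GC)"
  proof
    fix x y z assume "x \<sqsubseteq>\<^bsub>order_of GC\<^esub> y" "y \<sqsubseteq>\<^bsub>order_of GC\<^esub> z"
      "x \<in> carrier (order_of GC)" "y \<in> carrier (order_of GC)" "z \<in> carrier (order_of GC)"
    then show "x \<sqsubseteq>\<^bsub>order_of GC\<^esub> z" using le_trans C_closed by (auto simp: order_of_def)
  next
    fix x y assume "x \<in> carrier (order_of GC)" "y \<in> carrier (order_of GC)"
    then have "least (order_of GC) (x \<squnion>\<^sub>G y) (Upper (order_of GC) {x, y})"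
      by (auto simp: least_def Upper_def C_closed C_join join_ge1 join_ge2 join_least)
    then show "\<exists>s. least (order_of GC) s (Upper (order_of GC) {x, y})" by blast
  next
    fix x y assume "x \<in> carrier (order_of GC)" "y \<in> carrier (order_of GC)"
    then have "greatest (order_of GC) (x \<sqinter>\<^sub>G y) (Lower (order_of GC) {x, y})"
      by (auto simp: greatest_def Lower_def C_closed C_meet meet_le1 meet_le2 meet_greatest)
    then show "\<exists>s. greatest (order_of GC) s (Lower (order_of GC) {x, y})" by blast
  qed (auto simp: C_closed intro: le_antisym)
  then show ?thesis
    by (intro lgroup.intro lgroup_axioms.intro GC.is_group)
      (auto simp: C_closed mult_left_mono mult_right_mono)
qed

text \<open>Truncation in the interval over \<open>GC\<close> uses meets of
  \<open>order_of GC\<close>; they are the ambient ones because \<open>C\<close> is a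
  sublattice.\<close>

lemma GC_meet:
  assumes "g \<in> C" "h \<in> C"
  shows "g \<sqinter>\<^bsub>order_of GC\<^esub> h = g \<sqinter>\<^sub>G h"
  using assms C_closed C_meet[OF assms]
  by (intro order_of_meet_eqI) (auto simp: meet_le1 meet_le2 intro: meet_greatest le_antisym)

section \<open>Layers as central translates of the convex subgroup\<close>

lemma quotient_bounded:
  assumes t: "t \<in> U" and x: "x \<in> S t" and y: "y \<in> S t"
  shows "\<exists>p \<in> S 0. y \<otimes> inv x \<preceq> p"
proof
  have cl: "x \<in> carrier G" "y \<in> carrier G" using S_closed t x y by auto
  define w where "w = (x \<otimes> (inv y \<otimes> u)) \<sqinter>\<^sub>G u"
  have w: "w \<in> S 1" "w \<in> carrier G"
    using S_psum[OF t _ x S_rneg[OF t y]] t S_closed[of 1] by (auto simp: w_def)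
  show "u \<otimes> inv w \<in> S 0" using S_lneg[of 1 w] w by simp
  have "w \<preceq> x \<otimes> (inv y \<otimes> u)" using cl u_closed by (simp add: w_def meet_le1)
  then have "y \<otimes> inv x \<otimes> w \<preceq> y \<otimes> inv x \<otimes> (x \<otimes> (inv y \<otimes> u))"
    using cl w u_closed by (simp add: mult_left_mono)
  also have "\<dots> = u" using cl u_closed by (simp add: m_assoc inv_mult_cancel)
  finally show "y \<otimes> inv x \<preceq> u \<otimes> inv w" using cl w u_closed by (simp add: le_mult_inv_iff)
qed

lemma quotient_mem_C:
  assumes t: "t \<in> U" and x: "x \<in> S t" and y: "y \<in> S t"
  shows "y \<otimes> inv x \<in> C"
proof -
  have cl: "x \<in> carrier G" "y \<in> carrier G" using S_closed t x y by auto
  \<comment> \<open>The lower bound comes from the same estimate with \<open>x\<close> and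
    \<open>y\<close> exchanged, after inversion.\<close>
  obtain p q where pq: "p \<in> S 0" "q \<in> S 0" "y \<otimes> inv x \<preceq> p" "x \<otimes> inv y \<preceq> q"
    using quotient_bounded assms by meson
  then have "inv q \<preceq> y \<otimes> inv x"
    using inv_antimono[of "x \<otimes> inv y" q] cl S_closed[of 0 q] by (simp add: inv_mult_group)
  then show ?thesis using cl pq unfolding C_def by auto
qed

lemma S_eq_k_mult:
  assumes "t \<in> U" "x \<in> S t"
  shows "\<exists>g \<in> C. x = k t \<otimes> g"
proof
  show "x \<otimes> inv (k t) \<in> C" using quotient_mem_C assms k_mem by blast
  show "x = k t \<otimes> (x \<otimes> inv (k t))"
    using assms k_comm[of t "x \<otimes> inv (k t)"] k_closed S_closed by (simp add: m_assoc)
qed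

definition b where "b = u \<otimes> inv (k 1)"

lemma b_mem_C: "b \<in> C"
  unfolding b_def using quotient_mem_C[of 1 "k 1" u] k_mem u_mem_S1 by simp

lemma k_one_mult_b: "k 1 \<otimes> b = u"
  using k_comm[of 1 b] b_mem_C C_closed k_closed[of 1] u_closed by (simp add: b_def m_assoc)

lemma one_le_b: "\<one> \<preceq> b"
  unfolding b_def using S_le_u[of 1 "k 1"] k_mem[of 1] k_closed[of 1] u_closed
  by (simp add: le_mult_inv_iff)

text \<open>If \<open>inv q\<close> bounds \<open>g\<close> from below with \<open>q\<close> in
  layer 0, then \<open>k t\<close> is above \<open>q\<close> and compensates for it.\<close>

lemma k_mult_ge_one:
  assumes "t \<in> U" "0 < t" "g \<in> C"
  shows "\<one> \<preceq> k t \<otimes> g"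
proof -
  obtain q where q: "q \<in> S 0" "inv q \<preceq> g" using assms by (auto simp: C_def)
  then have "q \<preceq> k t" using S_less[of 0 t q] assms k_mem by simp
  then show ?thesis
    using mult_mono[of q "k t" "inv q" g] q S_closed[of 0 q] assms k_closed C_closed by simp
qed

text \<open>Mirror image of the lower bound: the complement of \<open>k t\<close> has positive index
  \<open>1 - t\<close>, so it is above all of layer 0 and hence above \<open>g\<close>.\<close>

lemma k_mult_le_u:
  assumes "t \<in> U" "t < 1" "g \<in> C"
  shows "k t \<otimes> g \<preceq> u"
proof -
  obtain p where p: "p \<in> S 0" "g \<preceq> p" using assms by (auto simp: C_def)
  then have "p \<preceq> inv (k t) \<otimes> u" using S_less[of 0 "1 - t" p] S_rneg assms k_mem by simp
  then have "g \<preceq> inv (k t) \<otimes> u"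
    using le_trans[of g p] p S_closed[of 0 p] assms C_closed k_closed u_closed by simp
  then show ?thesis using assms C_closed k_closed u_closed by (simp add: le_inv_mult_iff)
qed

lemma k_mult_interval_iff:
  assumes "t \<in> U" "g \<in> C"
  shows "\<one> \<preceq> k t \<otimes> g \<and> k t \<otimes> g \<preceq> u \<longleftrightarrow>
    (0 < t \<or> t = 0 \<and> \<one> \<preceq> g) \<and> (t < 1 \<or> t = 1 \<and> g \<preceq> b)"
proof -
  have "\<one> \<preceq> k t \<otimes> g \<longleftrightarrow> 0 < t \<or> t = 0 \<and> \<one> \<preceq> g"
    using assms k_mult_ge_one C_closed by (cases "t = 0") (auto simp: k_zero mem_unit_interval_of)
  moreover have "k 1 \<otimes> g \<preceq> u \<longleftrightarrow> g \<preceq> b"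
    using mult_left_le_iff[of g b "k 1"] k_one_mult_b assms C_closed b_mem_C k_closed by simp
  then have "k t \<otimes> g \<preceq> u \<longleftrightarrow> t < 1 \<or> t = 1 \<and> g \<preceq> b"
    using assms k_mult_le_u by (cases "t = 1") (auto simp: mem_unit_interval_of)
  ultimately show ?thesis by blast
qed

text \<open>Cancelling \<open>k s\<close> would put \<open>k (t - s)\<close> into \<open>C\<close>.
  Being positive it would lie in layer 0, but it lies in the disjoint layer
  \<open>t - s\<close>.\<close>

lemma k_mult_unique_aux:
  assumes st: "s \<in> U" "t \<in> U" "s < t" and gh: "g \<in> C" "h \<in> C"
  shows "k s \<otimes> g \<noteq> k t \<otimes> h"
proof
  assume eq: "k s \<otimes> g = k t \<otimes> h"
  have ts: "t - s \<in> U" using st by (auto simp: mem_unit_interval_of diff_mem)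
  have cl: "k s \<in> carrier G" "k (t - s) \<in> carrier G" "g \<in> carrier G" "h \<in> carrier G"
    using k_closed st ts gh C_closed by auto
  have "k t = k s \<otimes> k (t - s)"
    using k_add[of s "t - s"] st ts by (simp add: mem_unit_interval_of)
  then have "k s \<otimes> g = k s \<otimes> (k (t - s) \<otimes> h)" using eq cl by (simp add: m_assoc)
  then have "k (t - s) \<otimes> h = g" using cl by (metis inv_mult_cancel(1) m_closed)
  then have "k (t - s) = g \<otimes> inv h" using cl by (metis inv_solve_right)
  then have "k (t - s) \<in> C" using gh C_mult C_inv by simp
  then have "k (t - s) \<in> S 0" using C_pos_mem_S0 S_ge_one ts k_mem by blast
  then show False using S_disjoint[of 0 "t - s" "k (t - s)"] ts k_mem st by simp
qed

lemma k_mult_unique: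
  assumes "s \<in> U" "t \<in> U" "g \<in> C" "h \<in> C" "k s \<otimes> g = k t \<otimes> h"
  shows "s = t" "g = h"
proof -
  show "s = t" using assms k_mult_unique_aux by (metis linorder_neqE)
  then show "g = h" using assms C_closed k_closed by (metis inv_mult_cancel(1))
qed

text \<open>The element lies in some layer \<open>s\<close>, so it also has the form
  \<open>k s \<otimes> h\<close>; uniqueness of the index gives \<open>s = t\<close>.\<close>

lemma k_mult_mem_S:
  assumes "t \<in> U" "g \<in> C" "\<one> \<preceq> k t \<otimes> g" "k t \<otimes> g \<preceq> u"
  shows "k t \<otimes> g \<in> S t"
proof -
  obtain s where s: "s \<in> U" "k t \<otimes> g \<in> S s"
    using S_cover[of "k t \<otimes> g"] assms k_closed C_closed by auto
  then obtain h where "h \<in> C" "k t \<otimes> g = k s \<otimes> h" using S_eq_k_mult by blast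
  then show ?thesis using k_mult_unique(1)[of t s g h] assms s by simp
qed

sublocale lexC: lex_interval GC H b
proof -
  interpret GC: lgroup GC by (rule lgroup_GC)
  show "lex_interval GC H b" by unfold_locales (simp add: b_mem_C)
qed

lemma GC_inv: "g \<in> C \<Longrightarrow> inv\<^bsub>GC\<^esub> g = inv g"
  by (rule m_inv_consistent[OF subgroup_C])

lemma mem_interval_iff:
  "(t, g) \<in> carrier lexC.\<Gamma> \<longleftrightarrow> t \<in> U \<and> g \<in> C \<and> \<one> \<preceq> k t \<otimes> g \<and> k t \<otimes> g \<preceq> u"
proof (cases "t \<in> U \<and> g \<in> C")
  case True
  then show ?thesis
    using k_mult_interval_iff[of t g] lexC.mem_interval[of t g] by (simp add: mem_unit_interval_of)
next
  case False
  then show ?thesis using lexC.mem_interval[of t g] by (auto simp: mem_unit_interval_of)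
qed

text \<open>This direction has an explicit formula, while its inverse would have to read off the
  index of a layer. \<open>lex_represents\<close> asks for the inverse, which is taken
  afterwards.\<close>

lemma lex_interval_iso: "(\<lambda>(t, g). k t \<otimes> g) \<in> pmv_iso lexC.\<Gamma> (Gamma G u)" (is "?E \<in> _")
proof -
  have "inj_on ?E (carrier lexC.\<Gamma>)"
    using k_mult_unique by (auto simp: inj_on_def mem_interval_iff)
  moreover have "?E ` carrier lexC.\<Gamma> = carrier (Gamma G u)"
  proof
    show "?E ` carrier lexC.\<Gamma> \<subseteq> carrier (Gamma G u)"
      using k_closed C_closed by (auto simp: mem_interval_iff mem_carrier_Gamma[of _ G u])
    show "carrier (Gamma G u) \<subseteq> ?E ` carrier lexC.\<Gamma>"
    proof
      fix x assume "x \<in> carrier (Gamma G u)"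
      then have x: "x \<in> carrier G" "\<one> \<preceq> x" "x \<preceq> u" by (auto simp: Gamma_def)
      then obtain t where t: "t \<in> U" "x \<in> S t" using S_cover by blast
      then obtain g where "g \<in> C" "x = k t \<otimes> g" using S_eq_k_mult by blast
      then have "(t, g) \<in> carrier lexC.\<Gamma>" "x = ?E (t, g)"
        using t x by (auto simp: mem_interval_iff)
      then show "x \<in> ?E ` carrier lexC.\<Gamma>" by blast
    qed
  qed
  moreover have "?E (x \<oplus>\<^bsub>lexC.\<Gamma>\<^esub> y) = (?E x \<otimes> ?E y) \<sqinter>\<^sub>G u"
    if "x \<in> carrier lexC.\<Gamma>" "y \<in> carrier lexC.\<Gamma>" for x y
  proof -
    obtain s g t h where xy: "x = (s, g)" "y = (t, h)" by fastforce
    have st: "s \<in> U" "t \<in> U" "g \<in> C" "h \<in> C" "s \<in> H" "t \<in> H" "0 \<le> s" "0 \<le> t"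
      and S: "k s \<otimes> g \<in> S s" "k t \<otimes> h \<in> S t"
      using that k_mult_mem_S by (auto simp: xy mem_interval_iff mem_unit_interval_of)
    have cl: "k s \<in> carrier G" "k t \<in> carrier G" "g \<in> carrier G" "h \<in> carrier G"
      using st k_closed C_closed by auto
    \<comment> \<open>Centrality collects the two \<open>k\<close> factors. \<open>k_add\<close>
      reaches only up to index 1, which is why the case beyond 1 is argued differently.\<close>
    have sum: "k s \<otimes> g \<otimes> (k t \<otimes> h) = k (s + t) \<otimes> (g \<otimes> h)" if "s + t \<le> 1"
    proof -
      have "k s \<otimes> g \<otimes> (k t \<otimes> h) = k s \<otimes> (g \<otimes> k t) \<otimes> h" using cl by (simp add: m_assoc)
      also have "g \<otimes> k t = k t \<otimes> g" using k_comm st(2) cl(3) by simp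
      also have "k s \<otimes> (k t \<otimes> g) \<otimes> h = k (s + t) \<otimes> (g \<otimes> h)"
        using k_add[OF st(1,2) that] cl by (simp add: m_assoc)
      finally show ?thesis .
    qed
    consider "s + t < 1" | "s + t = 1" | "1 < s + t" by linarith
    then show ?thesis
    proof cases
      case 1
      then have "s + t \<in> U" using st by (simp add: mem_unit_interval_of add_mem)
      then have "(k (s + t) \<otimes> (g \<otimes> h)) \<sqinter>\<^sub>G u = k (s + t) \<otimes> (g \<otimes> h)"
        using k_mult_le_u[OF _ 1] st C_mult C_closed k_closed u_closed by (simp add: meet_absorb1)
      then show ?thesis using 1 st sum by (simp add: xy lexC.psum_interval)
    next
      case 2
      \<comment> \<open>Truncation by \<open>u\<close> turns into truncation by \<open>b\<close>,
        because \<open>u = k 1 \<otimes> b\<close> and left translation respects meets.\<close>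
      have "(k 1 \<otimes> (g \<otimes> h)) \<sqinter>\<^sub>G u = k 1 \<otimes> ((g \<otimes> h) \<sqinter>\<^sub>G b)"
        using mult_meet_distrib_left[of "g \<otimes> h" b "k 1"] k_one_mult_b cl b_mem_C C_closed
          k_closed[of 1] by simp
      then show ?thesis
        using 2 st sum b_mem_C by (simp add: xy lexC.psum_interval GC_meet C_mult)
    next
      case 3
      \<comment> \<open>Layer \<open>1 - t\<close> is strictly below layer \<open>s\<close>, so the
        complement of the second factor is below the first and the product is at least
        \<open>u\<close>.\<close>
      have "u \<otimes> inv (k t \<otimes> h) \<preceq> k s \<otimes> g"
        using S_less[of "1 - t" s] S_lneg[OF st(2) S(2)] st S(1) 3 by simp
      then have "u \<preceq> k s \<otimes> g \<otimes> (k t \<otimes> h)"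
        using cl u_closed mult_right_le_iff[of "u \<otimes> inv (k t \<otimes> h)" "k s \<otimes> g" "k t \<otimes> h"]
        by (simp add: m_assoc inv_mult_group inv_mult_cancel)
      then have "(k s \<otimes> g \<otimes> (k t \<otimes> h)) \<sqinter>\<^sub>G u = u"
        using cl u_closed by (simp add: meet_absorb2)
      then show ?thesis using 3 st k_one_mult_b by (simp add: xy lexC.psum_interval)
    qed
  qed
  moreover have "?E (lneg lexC.\<Gamma> x) = u \<otimes> inv (?E x) \<and> ?E (rneg lexC.\<Gamma> x) = inv (?E x) \<otimes> u"
    if "x \<in> carrier lexC.\<Gamma>" for x
  proof -
    obtain t g where x: "x = (t, g)" by fastforce
    have t: "t \<in> U" "1 - t \<in> U" "t \<in> H" "g \<in> C"
      using that by (auto simp: x mem_interval_iff mem_unit_interval_of diff_mem one_mem)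
    have cl: "k t \<in> carrier G" "k (1 - t) \<in> carrier G" "g \<in> carrier G" "b \<in> carrier G"
      using t k_closed C_closed b_mem_C by auto
    have u: "k (1 - t) \<otimes> k t \<otimes> b = u"
      using k_add[of "1 - t" t] t k_one_mult_b by simp
    \<comment> \<open>A complement is recognised by multiplying it with
      \<open>k t \<otimes> g\<close>: the central factors combine to \<open>k 1\<close>, the factors
      \<open>g\<close> and \<open>inv g\<close> cancel, and \<open>k 1 \<otimes> b = u\<close>
      remains.\<close>
    have "k (1 - t) \<otimes> (b \<otimes> inv g) \<otimes> (k t \<otimes> g) = k (1 - t) \<otimes> (b \<otimes> (inv g \<otimes> k t) \<otimes> g)"
      using cl by (simp add: m_assoc)
    also have "inv g \<otimes> k t = k t \<otimes> inv g"
      using k_comm[OF t(1), of "inv g"] cl by simp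
    also have "k (1 - t) \<otimes> (b \<otimes> (k t \<otimes> inv g) \<otimes> g) = k (1 - t) \<otimes> (b \<otimes> k t)"
      using cl by (simp add: m_assoc)
    also have "b \<otimes> k t = k t \<otimes> b" by (rule k_comm[OF t(1) cl(4), symmetric])
    also have "k (1 - t) \<otimes> (k t \<otimes> b) = u" using cl u by (simp add: m_assoc)
    finally have l: "k (1 - t) \<otimes> (b \<otimes> inv g) = u \<otimes> inv (k t \<otimes> g)"
      using cl u_closed by (simp add: inv_solve_right)
    have "k t \<otimes> g \<otimes> (k (1 - t) \<otimes> (inv g \<otimes> b)) = k t \<otimes> (g \<otimes> k (1 - t)) \<otimes> (inv g \<otimes> b)"
      using cl by (simp add: m_assoc)
    also have "g \<otimes> k (1 - t) = k (1 - t) \<otimes> g" by (rule k_comm[OF t(2) cl(3), symmetric])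
    also have "k t \<otimes> (k (1 - t) \<otimes> g) \<otimes> (inv g \<otimes> b) = k t \<otimes> k (1 - t) \<otimes> b"
      using cl by (simp add: m_assoc inv_mult_cancel)
    also have "k t \<otimes> k (1 - t) = k (1 - t) \<otimes> k t" by (rule k_comm[OF t(1) cl(2)])
    also have "\<dots> \<otimes> b = u" by (rule u)
    finally have r: "k (1 - t) \<otimes> (inv g \<otimes> b) = inv (k t \<otimes> g) \<otimes> u"
      using cl u_closed by (simp add: inv_solve_left)
    show ?thesis using t l r by (simp add: x lexC.lneg_interval lexC.rneg_interval GC_inv)
  qed
  moreover have "?E (pzero lexC.\<Gamma>) = \<one>" "?E (pone lexC.\<Gamma>) = u"
    using k_one_mult_b by (simp_all add: lexC.pzero_interval lexC.pone_interval k_zero)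
  ultimately show ?thesis
    unfolding pmv_iso_def bij_betw_def Gamma_simps[of G u] by blast
qed

end

section \<open>Transfer between the algebra and the graded group\<close>

text \<open>\<open>E\<close> respects the operations, and can be cancelled, only on the carrier of
  \<open>N\<close>. Closure of \<open>N\<close> is what allows cancelling it from values such as
  \<open>E (x' \<oplus> y')\<close>.\<close>

lemma pmv_iso_trans_inverse:
  assumes f: "f \<in> pmv_iso M K" and E: "E \<in> pmv_iso N K"
    and closed: "\<And>x y. \<lbrakk>x \<in> carrier N; y \<in> carrier N\<rbrakk> \<Longrightarrow> x \<oplus>\<^bsub>N\<^esub> y \<in> carrier N"
      "\<And>x. x \<in> carrier N \<Longrightarrow> lneg N x \<in> carrier N"
      "\<And>x. x \<in> carrier N \<Longrightarrow> rneg N x \<in> carrier N"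
      "pzero N \<in> carrier N" "pone N \<in> carrier N"
  shows "inv_into (carrier N) E \<circ> f \<in> pmv_iso M N"
proof -
  let ?D = "inv_into (carrier N) E"
  have E_bij: "bij_betw E (carrier N) (carrier K)" and f_bij: "bij_betw f (carrier M) (carrier K)"
    using E f by (simp_all add: pmv_iso_def)
  have DE: "?D (E x) = x" if "x \<in> carrier N" for x
    using E_bij that by (simp add: bij_betw_inv_into_left)
  have ex: "\<exists>y \<in> carrier N. f x = E y" if "x \<in> carrier M" for x
    using E_bij f_bij that by (metis bij_betw_apply bij_betw_imp_surj_on imageE)
  have "?D (f (x \<oplus>\<^bsub>M\<^esub> y)) = ?D (f x) \<oplus>\<^bsub>N\<^esub> ?D (f y)"
    if xy: "x \<in> carrier M" "y \<in> carrier M" for x y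
  proof -
    obtain x' y' where x': "x' \<in> carrier N" "f x = E x'" "y' \<in> carrier N" "f y = E y'"
      using ex xy by meson
    then have "f (x \<oplus>\<^bsub>M\<^esub> y) = E (x' \<oplus>\<^bsub>N\<^esub> y')"
      using xy f E by (simp add: pmv_iso_def)
    then show ?thesis using x' closed DE by simp
  qed
  moreover have "?D (f (lneg M x)) = lneg N (?D (f x)) \<and> ?D (f (rneg M x)) = rneg N (?D (f x))"
    if x: "x \<in> carrier M" for x
  proof -
    obtain x' where x': "x' \<in> carrier N" "f x = E x'" using ex x by meson
    then have "f (lneg M x) = E (lneg N x')" "f (rneg M x) = E (rneg N x')"
      using x f E by (simp_all add: pmv_iso_def)
    then show ?thesis using x' closed DE by simp
  qed
  moreover have "?D (f (pzero M)) = pzero N" "?D (f (pone M)) = pone N"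
    using f E closed DE[of "pzero N"] DE[of "pone N"] by (simp_all add: pmv_iso_def)
  moreover have "bij_betw (?D \<circ> f) (carrier M) (carrier N)"
    using bij_betw_trans[OF f_bij bij_betw_inv_into[OF E_bij]] .
  ultimately show ?thesis by (simp add: pmv_iso_def)
qed

lemma (in central_grading) lex_represents_GC:
  assumes "f \<in> pmv_iso M (Gamma G u)" and "b \<noteq> \<one>"
  shows "lex_represents H M GC b"
proof -
  have "pzero lexC.\<Gamma> \<in> carrier lexC.\<Gamma>" "pone lexC.\<Gamma> \<in> carrier lexC.\<Gamma>"
    using zero_mem one_mem b_mem_C C_closed S0_subset_C[OF one_mem_S0]
    by (auto simp: lexC.pzero_interval lexC.pone_interval lexC.mem_interval)
  then have "inv_into (carrier lexC.\<Gamma>) (\<lambda>(t, g). k t \<otimes> g) \<circ> f \<in> pmv_iso M lexC.\<Gamma>"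
    by (intro pmv_iso_trans_inverse[OF assms(1) lex_interval_iso] lexC.psum_interval_closed
        lexC.lneg_interval_closed lexC.rneg_interval_closed)
  then show ?thesis
    using lgroup_GC b_mem_C one_le_b assms(2) unfolding lex_represents_def by auto
qed

text \<open>The order of \<open>M\<close> supplies \<open>z\<close> with
  \<open>y = x \<oplus> z\<close>. Since \<open>f z\<close> is positive and \<open>f x\<close> is
  below \<open>u\<close>, truncation at \<open>u\<close> keeps \<open>f x \<otimes> f z\<close>
  above \<open>f x\<close>.\<close>

lemma (in pseudo_mv_algebra) pmv_le_imp_grp_le:
  assumes "lgroup G" "u \<in> carrier G" "f \<in> pmv_iso M (Gamma G u)"
    and xy: "x \<in> carrier M" "y \<in> carrier M" "pmv_le M x y"
  shows "f x \<preceq>\<^bsub>G\<^esub> f y"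
proof -
  interpret G: lgroup G by fact
  define z where "z = rneg M x \<odot> y"
  have z: "z \<in> carrier M" "x \<oplus> z = y"
    using xy by (auto simp: z_def pmv_le_def pjoin_def pprod_def psum_closed lneg_closed rneg_closed)
  have "f w \<in> carrier (Gamma G u)" if "w \<in> carrier M" for w
    using assms(3) that by (auto simp: pmv_iso_def bij_betw_def)
  then have fc: "f w \<in> carrier G \<and> \<one>\<^bsub>G\<^esub> \<preceq>\<^bsub>G\<^esub> f w \<and> f w \<preceq>\<^bsub>G\<^esub> u" if "w \<in> carrier M" for w
    using that by (auto simp: Gamma_def)
  have "f x \<preceq>\<^bsub>G\<^esub> f x \<otimes>\<^bsub>G\<^esub> f z"
    using G.mult_left_mono[of "\<one>\<^bsub>G\<^esub>" "f z" "f x"] fc xy z by simp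
  then have "f x \<preceq>\<^bsub>G\<^esub> G.lmeet (f x \<otimes>\<^bsub>G\<^esub> f z) u"
    using fc xy z assms(2) by (simp add: G.meet_greatest)
  moreover have "f (x \<oplus> z) = G.lmeet (f x \<otimes>\<^bsub>G\<^esub> f z) u"
    using assms(3) xy(1) z(1) by (simp add: pmv_iso_def Gamma_def)
  ultimately show ?thesis by (simp add: z)
qed

lemma perfect_closed:
  assumes "perfect H M Ms" "t \<in> unit_interval_of H" "x \<in> Ms t"
  shows "x \<in> carrier M"
proof -
  have "(\<Union>t \<in> unit_interval_of H. Ms t) = carrier M" using assms(1) by (simp add: perfect_def)
  then show ?thesis using assms(2,3) by blast
qed

text \<open>Each clause is carried along \<open>f\<close>. Only the order of the layers and
  additivity need more than a bijective homomorphism, because \<open>M\<close> has its own order and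
  a truncated sum.\<close>

lemma central_grading_of_central_system:
  fixes f :: "'a \<Rightarrow> 'l"
  assumes H: "real_subgroup H" and M: "pseudo_mv_algebra M"
    and G: "lgroup G" and u: "u \<in> carrier G" and f: "f \<in> pmv_iso M (Gamma G u)"
    and perf: "perfect H M Ms" and c: "central_system H M Ms G f c"
  shows "central_grading G H u (\<lambda>t. f ` Ms t) (f \<circ> c)"
proof -
  interpret real_subgroup H by fact
  interpret M: pseudo_mv_algebra M by fact
  interpret G: lgroup G by fact
  let ?U = "unit_interval_of H"
  have bij: "bij_betw f (carrier M) (carrier (Gamma G u))" using f by (simp add: pmv_iso_def)
  have f_psum: "f (x \<oplus>\<^bsub>M\<^esub> y) = G.lmeet (f x \<otimes>\<^bsub>G\<^esub> f y) u"
    if "x \<in> carrier M" "y \<in> carrier M" for x y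
    using f that by (simp add: pmv_iso_def Gamma_def)
  have f_neg: "f (lneg M x) = u \<otimes>\<^bsub>G\<^esub> inv\<^bsub>G\<^esub> f x" "f (rneg M x) = inv\<^bsub>G\<^esub> f x \<otimes>\<^bsub>G\<^esub> u"
    if "x \<in> carrier M" for x
    using f that by (simp_all add: pmv_iso_def Gamma_def)
  have f_closed: "f x \<in> carrier G \<and> \<one>\<^bsub>G\<^esub> \<preceq>\<^bsub>G\<^esub> f x \<and> f x \<preceq>\<^bsub>G\<^esub> u" if "x \<in> carrier M" for x
    using bij_betw_apply[OF bij that] by (simp add: Gamma_def)
  have f_surj: "\<exists>x \<in> carrier M. y = f x" if "y \<in> carrier G" "\<one>\<^bsub>G\<^esub> \<preceq>\<^bsub>G\<^esub> y" "y \<preceq>\<^bsub>G\<^esub> u" for y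
  proof -
    have "y \<in> carrier (Gamma G u)" using that by (simp add: Gamma_def)
    then show ?thesis using bij_betw_imp_surj_on[OF bij] by blast
  qed
  note Ms = perfect_closed[OF perf]
  have cover: "(\<Union>t \<in> ?U. Ms t) = carrier M" and disj: "disjoint_family_on Ms ?U"
    and below: "\<forall>s \<in> ?U. \<forall>t \<in> ?U. s < t \<longrightarrow> (\<forall>x \<in> Ms s. \<forall>y \<in> Ms t. pmv_le M x y)"
    and neg: "\<forall>t \<in> ?U. lneg M ` Ms t = Ms (1 - t) \<and> rneg M ` Ms t = Ms (1 - t)"
    and psum: "\<forall>s \<in> ?U. \<forall>t \<in> ?U. \<forall>x \<in> Ms s. \<forall>y \<in> Ms t. x \<oplus>\<^bsub>M\<^esub> y \<in> Ms (min (s + t) 1)"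
    using perf unfolding perfect_def by - (elim conjE, assumption)+
  have c0: "c 0 = pzero M" and c_mem: "\<And>t. t \<in> ?U \<Longrightarrow> f (c t) \<in> center G \<and> c t \<in> Ms t"
    and c_add: "\<And>s t. \<lbrakk>s \<in> ?U; t \<in> ?U; s + t \<le> 1\<rbrakk> \<Longrightarrow>
      pmv_le M (c s) (lneg M (c t)) \<and> c (s + t) = c s \<oplus>\<^bsub>M\<^esub> c t"
    using c unfolding central_system_def by blast+
  show ?thesis
  proof unfold_locales
    show "u \<in> carrier G" by fact
  next
    fix t x assume "t \<in> ?U" "x \<in> f ` Ms t"
    then obtain y where y: "t \<in> ?U" "y \<in> Ms t" "x = f y" "y \<in> carrier M" using Ms by blast
    then show "x \<in> carrier G \<and> \<one>\<^bsub>G\<^esub> \<preceq>\<^bsub>G\<^esub> x \<and> x \<preceq>\<^bsub>G\<^esub> u" using f_closed by simp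
    show "u \<otimes>\<^bsub>G\<^esub> inv\<^bsub>G\<^esub> x \<in> f ` Ms (1 - t)" "inv\<^bsub>G\<^esub> x \<otimes>\<^bsub>G\<^esub> u \<in> f ` Ms (1 - t)"
      using neg y f_neg[of y, symmetric] by (metis image_eqI)+
  next
    fix x assume "x \<in> carrier G" "\<one>\<^bsub>G\<^esub> \<preceq>\<^bsub>G\<^esub> x" "x \<preceq>\<^bsub>G\<^esub> u"
    then obtain y where "y \<in> carrier M" "x = f y" using f_surj by blast
    then show "\<exists>t \<in> ?U. x \<in> f ` Ms t" using cover by blast
  next
    fix s t x assume *: "s \<in> ?U" "t \<in> ?U" "x \<in> f ` Ms s" "x \<in> f ` Ms t"
    then obtain y z where "y \<in> Ms s" "z \<in> Ms t" "f y = f z" by auto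
    moreover from this have "y = z"
      using bij_betw_imp_inj_on[OF bij] Ms * by (metis inj_onD)
    ultimately show "s = t" using disj * unfolding disjoint_family_on_def by blast
  next
    fix s t x y assume *: "s \<in> ?U" "t \<in> ?U" "x \<in> f ` Ms s" "y \<in> f ` Ms t"
    then obtain x' y' where x': "x' \<in> Ms s" "x = f x'" "y' \<in> Ms t" "y = f y'" by auto
    then have cl: "x' \<in> carrier M" "y' \<in> carrier M" using * Ms by auto
    show "x \<preceq>\<^bsub>G\<^esub> y" if "s < t"
      using M.pmv_le_imp_grp_le[OF G u f cl] below * x' that by simp
    show "G.lmeet (x \<otimes>\<^bsub>G\<^esub> y) u \<in> f ` Ms (min (s + t) 1)"
      using psum * x' f_psum[OF cl, symmetric] by simp
  next
    fix t assume t: "t \<in> ?U"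
    then show "(f \<circ> c) t \<in> f ` Ms t" using c_mem by simp
    fix x assume "x \<in> carrier G"
    then show "(f \<circ> c) t \<otimes>\<^bsub>G\<^esub> x = x \<otimes>\<^bsub>G\<^esub> (f \<circ> c) t" using c_mem[OF t] by (simp add: center_def)
  next
    show "(f \<circ> c) 0 = \<one>\<^bsub>G\<^esub>" using c0 f by (simp add: pmv_iso_def Gamma_def)
  next
    fix s t assume st: "s \<in> ?U" "t \<in> ?U" "s + t \<le> 1"
    have cl: "c s \<in> carrier M" "c t \<in> carrier M" using c_mem Ms st by blast+
    \<comment> \<open>That the partial sum of \<open>c s\<close> and \<open>c t\<close> is defined
      means that the product of their images stays below \<open>u\<close>, so the truncation has no
      effect.\<close>
    have "f (c s) \<preceq>\<^bsub>G\<^esub> u \<otimes>\<^bsub>G\<^esub> inv\<^bsub>G\<^esub> f (c t)"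
      using M.pmv_le_imp_grp_le[OF G u f cl(1) M.lneg_closed[OF cl(2)]] c_add[OF st]
        f_neg(1)[OF cl(2)] by simp
    then have "f (c s) \<otimes>\<^bsub>G\<^esub> f (c t) \<preceq>\<^bsub>G\<^esub> u" using f_closed cl u by (simp add: G.le_mult_inv_iff)
    then show "(f \<circ> c) (s + t) = (f \<circ> c) s \<otimes>\<^bsub>G\<^esub> (f \<circ> c) t"
      using c_add[OF st] f_psum[OF cl] f_closed cl u by (simp add: G.meet_absorb1)
  qed
qed

text \<open>The group found is carried by a subset of \<open>L\<close> and so has its type;
  uniqueness compares representing groups over two unrelated types.\<close>

theorem theorem6p1:
  fixes H :: "real set" and M :: "'a pmv" and Ms :: "real \<Rightarrow> 'a set"
    and L :: "'l ordered_monoid" and u :: 'l and f :: "'a \<Rightarrow> 'l"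
  assumes "subgroup H real_lgroup" and "1 \<in> H"
    and "pseudo_mv_algebra M"
    and "lgroup L" and "strong_unit L u" and "f \<in> pmv_iso M (Gamma L u)"
    and "weak_perfect H M Ms L f"
    and "\<not> strong_perfect H M Ms L f"
  shows "(\<exists>(G :: 'l ordered_monoid) b. lex_represents H M G b) \<and>
    (\<forall>(G1 :: 'g ordered_monoid) b1 (G2 :: 'h ordered_monoid) b2.
      lex_represents H M G1 b1 \<and> lex_represents H M G2 b2 \<longrightarrow> lgroup_isomorphic G1 G2)"
proof -
  have H: "real_subgroup H" using assms(1,2) by (rule real_subgroup.intro)
  have u: "u \<in> carrier L" using assms(5) by (simp add: strong_unit_def)
  obtain c where perf: "perfect H M Ms" and c: "central_system H M Ms L f c"
    using assms(7) by (auto simp: weak_perfect_def)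
  interpret M: pseudo_mv_algebra M by fact
  interpret cg: central_grading L H u "\<lambda>t. f ` Ms t" "f \<circ> c"
    by (rule central_grading_of_central_system[OF H assms(3,4) u assms(6) perf c])
  have "cg.b \<noteq> \<one>\<^bsub>L\<^esub>"
  proof
    assume "cg.b = \<one>\<^bsub>L\<^esub>"
    then have "f (c 1) = u" using cg.k_one_mult_b cg.k_closed[of 1] by simp
    also have "u = f (pone M)" using assms(6) by (simp add: pmv_iso_def Gamma_def)
    finally have "f (c 1) = f (pone M)" .
    moreover have "c 1 \<in> carrier M"
      using c cg.U_facts(2) perfect_closed[OF perf cg.U_facts(2)] by (simp add: central_system_def)
    moreover have "inj_on f (carrier M)" using assms(6) by (simp add: pmv_iso_def bij_betw_def)
    ultimately have "c 1 = pone M" using M.pone_closed by (meson inj_onD)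
    then show False using assms(8) perf c by (auto simp: strong_perfect_def)
  qed
  then have "lex_represents H M cg.GC cg.b" using cg.lex_represents_GC[OF assms(6)] by blast
  then show ?thesis
    by (intro conjI exI allI impI; (elim conjE)?)
      (assumption, rule lex_represents_unique[OF H assms(3)])
qed

end
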